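(* Let $m\geq1$ and $k\geq2$ be integers and let $G$ be an $m$-connected graph of order $n\geq\max\{(7k-2)m+4,\ (k-1)m^2+\frac12(3k+1)m+\frac92\}$. If $\rho(G)\geq\rho(K_m\vee(K_{n-km-1}+I_{km-m+1}))$, then $G$ has a spanning $k$-tree unless $G\cong K_m\vee(K_{n-km-1}+I_{km-m+1})$.
   Context: All graphs are finite and simple. $\rho(G)$ is the spectral radius of the adjacency matrix of $G$. A spanning $k$-tree of a connected graph is a spanning tree in which every vertex has degree at most $k$. $K_n$ is the complete graph and $I_n$ the edgeless graph on $n$ vertices; $G_1+G_2$ denotes disjoint union and $G_1\vee G_2$ the join. *)

theory Defs
  imports "HOL-Analysis.Analysis" "Jordan_Normal_Form.Spectral_Radius"
begin

definition simple_graph :: "nat \<Rightarrow> (nat \<Rightarrow> nat \<Rightarrow> bool) \<Rightarrow> bool" where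
  "simple_graph n E \<longleftrightarrow> (\<forall>i j. E i j \<longrightarrow> i < n \<and> j < n \<and> i \<noteq> j \<and> E j i)"

text \<open>Adjacency matrix (as a complex matrix, for the library spectral radius).\<close>
definition adj_mat :: "nat \<Rightarrow> (nat \<Rightarrow> nat \<Rightarrow> bool) \<Rightarrow> complex mat" where
  "adj_mat n E = mat n n (\<lambda>(i, j). if E i j then 1 else 0)"

definition rho :: "nat \<Rightarrow> (nat \<Rightarrow> nat \<Rightarrow> bool) \<Rightarrow> real" where
  "rho n E = spectral_radius (adj_mat n E)"

definition connected_on :: "nat set \<Rightarrow> (nat \<Rightarrow> nat \<Rightarrow> bool) \<Rightarrow> bool" where
  "connected_on S E \<longleftrightarrow>
     (\<forall>u\<in>S. \<forall>v\<in>S. (\<lambda>x y. x \<in> S \<and> y \<in> S \<and> E x y)\<^sup>*\<^sup>* u v)"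

definition m_connected :: "nat \<Rightarrow> (nat \<Rightarrow> nat \<Rightarrow> bool) \<Rightarrow> nat \<Rightarrow> bool" where
  "m_connected n E m \<longleftrightarrow> m < n \<and>
     (\<forall>S. S \<subseteq> {0..<n} \<longrightarrow> card S < m \<longrightarrow> connected_on ({0..<n} - S) E)"

text \<open>A spanning tree on {0..<n}: a connected spanning subgraph in which every
  edge is a bridge (i.e. acyclic).\<close>
definition spanning_tree :: "nat \<Rightarrow> (nat \<Rightarrow> nat \<Rightarrow> bool) \<Rightarrow> (nat \<Rightarrow> nat \<Rightarrow> bool) \<Rightarrow> bool" where
  "spanning_tree n E T \<longleftrightarrow> simple_graph n T \<and> (\<forall>i j. T i j \<longrightarrow> E i j) \<and>
     connected_on {0..<n} T \<and>
     (\<forall>u v. T u v \<longrightarrow>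
        \<not> connected_on {0..<n} (\<lambda>x y. T x y \<and> {x, y} \<noteq> {u, v}))"

definition has_spanning_k_tree :: "nat \<Rightarrow> (nat \<Rightarrow> nat \<Rightarrow> bool) \<Rightarrow> nat \<Rightarrow> bool" where
  "has_spanning_k_tree n E k \<longleftrightarrow>
     (\<exists>T. spanning_tree n E T \<and> (\<forall>u<n. card {v. T u v} \<le> k))"

definition graph_iso :: "nat \<Rightarrow> (nat \<Rightarrow> nat \<Rightarrow> bool) \<Rightarrow> (nat \<Rightarrow> nat \<Rightarrow> bool) \<Rightarrow> bool" where
  "graph_iso n E F \<longleftrightarrow> (\<exists>f. bij_betw f {0..<n} {0..<n} \<and>
     (\<forall>i<n. \<forall>j<n. E i j \<longleftrightarrow> F (f i) (f j)))"

text \<open>K_m \<or> (K_{n-km-1} + I_{km-m+1}) on {0..<n}: vertices 0..m-1 form the K_m,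
  vertices m..n-km-2+m form K_{n-km-1}, the remaining km-m+1 vertices are independent.\<close>
definition extremal_graph :: "nat \<Rightarrow> nat \<Rightarrow> nat \<Rightarrow> nat \<Rightarrow> nat \<Rightarrow> bool" where
  "extremal_graph n k m i j \<longleftrightarrow> i < n \<and> j < n \<and> i \<noteq> j \<and>
     (i < m \<or> j < m \<or> (i < m + (n - k*m - 1) \<and> j < m + (n - k*m - 1)))"

end

theory Submission
  imports Defs
begin

text \<open>Embed \<open>G\<close> into an edge-maximal graph \<open>G'\<close> on the same vertices without a spanning
  \<open>k\<close>-tree. By the closure lemma of Kano and Kishimoto, nonadjacent vertices of \<open>G'\<close> have
  degree sum at most \<open>n - 2 - (k - 2)m\<close>. Put \<open>t = (k - 1)m + 1\<close>. Since
  \<open>\<rho>(G) \<ge> n - t - 1\<close>, Hong's inequality \<open>\<rho>\<^sup>2 \<le> 2e - n + 1\<close> gives \<open>G'\<close> so many edges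
  that the degree condition forces a clique of order \<open>n - t\<close>. The vertices outside the clique
  then have degree exactly \<open>m\<close>, and every clique vertex is adjacent to all of them or to none;
  \<open>m\<close>-connectivity makes the number of the former equal to \<open>m\<close>, so \<open>G'\<close> is the extremal
  graph. Strict monotonicity of the spectral radius gives \<open>G = G'\<close>.\<close>

section \<open>Spectral radius\<close>

unbundle no vec_syntax

text \<open>In terms of \<open>t\<close> the two lower bounds on \<open>n\<close> read
  \<open>7t + 5m - 3 \<le> n\<close> and \<open>tm + m + 3t/2 + 3 \<le> n\<close>. Put
  \<open>s = (k - 2)m\<close>, so that \<open>t = s + m + 1\<close>. In the edge-maximal graph the
  vertices of degree above \<open>(n - s - 2)/2\<close> are pairwise adjacent. A maximal clique
  containing them, of order \<open>w\<close>, bounds every outside degree twice: by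
  \<open>(n - s - 2)/2\<close>, and by \<open>n - 1 - s - w\<close>, since an outside vertex misses
  some clique vertex, whose degree is at least \<open>w - 1\<close>. For
  \<open>w \<le> n - t - 1\<close> the resulting degree sum is too small for Hong's inequality; the
  first bound on \<open>n\<close> shows this at \<open>w = (n - s)/2\<close>, the second at
  \<open>w = n - t - 1\<close>, and linearity or convexity does the rest. Edge-maximality is what
  turns the closure lemma, a statement about a single pair, into a condition on all nonadjacent
  pairs at once. Nonnegative vectors with \<open>\<mu> x \<le> A x\<close> replace Perron vectors
  throughout: such an inequality survives the addition of edges.\<close>

lemma connected_on_crossing:
  assumes "connected_on V E" "a \<in> V" "b \<in> V" "P a" "\<not> P b"
  obtains i j where "i \<in> V" "j \<in> V" "E i j" "P i" "\<not> P j"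
proof -
  have "(\<lambda>x y. x \<in> V \<and> y \<in> V \<and> E x y)\<^sup>*\<^sup>* a b"
    using assms by (auto simp: connected_on_def)
  then have "\<exists>i j. i \<in> V \<and> j \<in> V \<and> E i j \<and> P i \<and> \<not> P j"
    using assms(4,5) by (induction rule: rtranclp_induct) blast+
  then show thesis using that by blast
qed

lemma simple_graph_less: "simple_graph n E \<Longrightarrow> E i j \<Longrightarrow> i < n \<and> j < n"
  unfolding simple_graph_def by blast

lemma simple_graph_irrefl: "simple_graph n E \<Longrightarrow> \<not> E i i"
  unfolding simple_graph_def by blast

lemma simple_graph_symp: "simple_graph n E \<Longrightarrow> symp E"
  unfolding simple_graph_def by (intro sympI) blast

lemma simple_graph_finite_nbrs: "simple_graph n E \<Longrightarrow> finite {j. E i j}"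
  by (rule finite_subset[of _ "{0..<n}"]) (auto simp: simple_graph_def)

section \<open>The spectral radius through nonnegative test vectors\<close>

lemma adj_mat_carrier: "adj_mat n E \<in> carrier_mat n n"
  by (simp add: adj_mat_def)

lemma adj_mat_mult_vec:
  assumes "simple_graph n E" "i < n"
  shows "(adj_mat n E *\<^sub>v vec n f) $ i = (\<Sum>j\<in>{j. E i j}. f j)"
proof -
  have "(adj_mat n E *\<^sub>v vec n f) $ i = (\<Sum>j\<in>{0..<n}. if E i j then f j else 0)"
    using assms(2) by (auto simp: adj_mat_def scalar_prod_def intro!: sum.cong)
  also have "\<dots> = (\<Sum>j\<in>{j. E i j}. f j)"
    using assms(1) by (intro sum.mono_neutral_cong_right) (auto simp: simple_graph_def)
  finally show ?thesis .
qed

lemma rho_nonneg: "n > 0 \<Longrightarrow> 0 \<le> rho n E"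
  using spectral_radius_mem_max(1)[OF adj_mat_carrier, of n E] by (auto simp: rho_def)

text \<open>The entrywise moduli of an eigenvector for an eigenvalue of largest modulus; the
  triangle inequality turns the eigenvalue equation into an inequality.\<close>

lemma rho_subeigenvector:
  assumes E: "simple_graph n E" and n: "n > 0"
  obtains x :: "nat \<Rightarrow> real" where "\<And>i. 0 \<le> x i" "\<exists>i<n. 0 < x i"
    "\<And>i. i < n \<Longrightarrow> rho n E * x i \<le> (\<Sum>j\<in>{j. E i j}. x j)"
proof -
  obtain e where e: "rho n E = cmod e" "eigenvalue (adj_mat n E) e"
    using spectral_radius_mem_max(1)[OF adj_mat_carrier n, of E]
    by (auto simp: rho_def spectrum_def)
  then obtain v where v: "v \<in> carrier_vec n" "v \<noteq> 0\<^sub>v n" "adj_mat n E *\<^sub>v v = e \<cdot>\<^sub>v v"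
    using adj_mat_carrier[of n E] by (auto simp: eigenvalue_def eigenvector_def)
  have v': "v = vec n (($) v)" using v(1) by auto
  show thesis
  proof
    show "0 \<le> cmod (v $ i)" for i by simp
    show "\<exists>i<n. 0 < cmod (v $ i)"
      using v(1,2) by (metis carrier_vecD eq_vecI index_zero_vec zero_less_norm_iff)
    show "rho n E * cmod (v $ i) \<le> (\<Sum>j\<in>{j. E i j}. cmod (v $ j))" if i: "i < n" for i
    proof -
      have "e * v $ i = (adj_mat n E *\<^sub>v vec n (($) v)) $ i"
        using v(1,3) i v' by simp
      also have "\<dots> = (\<Sum>j\<in>{j. E i j}. v $ j)" by (rule adj_mat_mult_vec[OF E i])
      finally have "rho n E * cmod (v $ i) = cmod (\<Sum>j\<in>{j. E i j}. v $ j)"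
        by (simp add: e(1) flip: norm_mult)
      then show ?thesis by (simp add: norm_sum)
    qed
  qed
qed

text \<open>The Collatz-Wielandt lower bound. If \<open>r\<close> lay strictly between
  \<open>rho n E\<close> and \<open>\<mu>\<close>, the powers of \<open>A / r\<close> would have
  bounded entries, as the spectral radius is below 1; yet nonnegativity makes them stretch
  \<open>y\<close> at least by the unbounded factors \<open>(\<mu> / r) ^ l\<close>.\<close>

lemma le_rho_of_subeigenvector:
  fixes y :: "nat \<Rightarrow> real"
  assumes E: "simple_graph n E" and y: "\<And>i. i < n \<Longrightarrow> 0 \<le> y i" "\<exists>i<n. 0 < y i"
    and sub: "\<And>i. i < n \<Longrightarrow> \<mu> * y i \<le> (\<Sum>j\<in>{j. E i j}. y j)"
  shows "\<mu> \<le> rho n E"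
proof (rule ccontr)
  assume "\<not> \<mu> \<le> rho n E"
  then obtain r where r: "rho n E < r" "r < \<mu>" using dense[of "rho n E" \<mu>] by auto
  have n: "n > 0" using y(2) by auto
  have r0: "r > 0" using r rho_nonneg[OF n, of E] by linarith
  let ?A = "adj_mat n E"
  let ?B = "complex_of_real (1 / r) \<cdot>\<^sub>m ?A"
  let ?v = "\<lambda>z. vec n (\<lambda>i. complex_of_real (z i))"
  have B: "?B \<in> carrier_mat n n" using adj_mat_carrier by simp
  have Bv: "?B *\<^sub>v ?v z = ?v (\<lambda>i. (\<Sum>j\<in>{j. E i j}. z j) / r)" for z
  proof (rule eq_vecI)
    fix i assume "i < dim_vec (?v (\<lambda>i. (\<Sum>j\<in>{j. E i j}. z j) / r))"
    then have i: "i < n" by simp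
    have "(?B *\<^sub>v ?v z) $ i = complex_of_real (1 / r) * (?A *\<^sub>v ?v z) $ i"
      using i adj_mat_carrier[of n E] by simp
    also have "\<dots> = complex_of_real ((\<Sum>j\<in>{j. E i j}. z j) / r)"
      by (simp add: adj_mat_mult_vec[OF E i])
    finally show "(?B *\<^sub>v ?v z) $ i = ?v (\<lambda>i. (\<Sum>j\<in>{j. E i j}. z j) / r) $ i"
      using i by simp
  qed (use adj_mat_carrier[of n E] in simp)
  have "spectral_radius ?B < 1"
  proof -
    obtain e where e: "spectral_radius ?B = cmod e" "eigenvalue ?B e"
      using spectral_radius_mem_max(1)[OF B n] by (auto simp: spectrum_def)
    then obtain v where v: "v \<in> carrier_vec n" "v \<noteq> 0\<^sub>v n" "?B *\<^sub>v v = e \<cdot>\<^sub>v v"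
      using B by (auto simp: eigenvalue_def eigenvector_def)
    have "?A *\<^sub>v v = (of_real r * e) \<cdot>\<^sub>v v"
    proof (rule eq_vecI)
      fix i assume "i < dim_vec ((of_real r * e) \<cdot>\<^sub>v v)"
      then have i: "i < n" using v(1) by simp
      have "complex_of_real (1 / r) * (?A *\<^sub>v v) $ i = (?B *\<^sub>v v) $ i"
        using i v(1) adj_mat_carrier[of n E] by simp
      also have "\<dots> = e * v $ i" using i v by simp
      finally show "(?A *\<^sub>v v) $ i = ((of_real r * e) \<cdot>\<^sub>v v) $ i"
        using i v(1) r0 by (simp add: field_simps)
    qed (use v(1) adj_mat_carrier[of n E] in simp)
    then have "of_real r * e \<in> spectrum ?A"
      using v adj_mat_carrier[of n E] by (auto simp: spectrum_def eigenvalue_def eigenvector_def)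
    then have "cmod (of_real r * e) \<le> rho n E"
      unfolding rho_def by (intro spectral_radius_mem_max(2)[OF adj_mat_carrier n]) blast
    then have "r * cmod e \<le> rho n E" using r0 by (simp add: norm_mult)
    then have "r * cmod e < r * 1" using r by linarith
    then show ?thesis using e(1) r0 by simp
  qed
  then obtain c where c: "\<And>l. norm_bound (?B ^\<^sub>m l) c"
    using spectral_radius_jnf_norm_bound_less_1_upper_triangular[OF B] by blast
  \<comment> \<open>The start vector \<open>z\<close> and the factor \<open>a\<close> are general
    because the power unfolds on the right: the induction step applies the hypothesis to the image
    of \<open>z\<close>, with \<open>a\<close> multiplied by \<open>\<mu> / r\<close>.\<close>
  have grow: "\<exists>w. ?B ^\<^sub>m l *\<^sub>v ?v z = ?v w \<and> (\<forall>i<n. a * (\<mu> / r) ^ l * y i \<le> w i)"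
    if "0 \<le> a" "\<forall>i<n. a * y i \<le> z i" for a z l
    using that
  proof (induction l arbitrary: a z)
    case 0
    then show ?case using adj_mat_carrier[of n E] by (intro exI[of _ z]) simp
  next
    case (Suc l)
    let ?z = "\<lambda>i. (\<Sum>j\<in>{j. E i j}. z j) / r"
    have "\<exists>w. ?B ^\<^sub>m l *\<^sub>v ?v ?z = ?v w \<and> (\<forall>i<n. (a * (\<mu> / r)) * (\<mu> / r) ^ l * y i \<le> w i)"
    proof (rule Suc.IH)
      show "0 \<le> a * (\<mu> / r)" using Suc.prems(1) r r0 by simp
      show "\<forall>i<n. a * (\<mu> / r) * y i \<le> ?z i"
      proof (intro allI impI)
        fix i assume i: "i < n"
        have "a * (\<mu> * y i) \<le> a * (\<Sum>j\<in>{j. E i j}. y j)"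
          using sub[OF i] Suc.prems(1) by (rule mult_left_mono)
        also have "\<dots> = (\<Sum>j\<in>{j. E i j}. a * y j)" by (rule sum_distrib_left)
        also have "\<dots> \<le> (\<Sum>j\<in>{j. E i j}. z j)"
          using Suc.prems(2) E by (intro sum_mono) (auto simp: simple_graph_def)
        finally show "a * (\<mu> / r) * y i \<le> ?z i" using r0 by (simp add: field_simps)
      qed
    qed
    then obtain w where w: "?B ^\<^sub>m l *\<^sub>v ?v ?z = ?v w"
      "\<forall>i<n. (a * (\<mu> / r)) * (\<mu> / r) ^ l * y i \<le> w i" by blast
    have "?B ^\<^sub>m Suc l *\<^sub>v ?v z = ?B ^\<^sub>m l *\<^sub>v (?B *\<^sub>v ?v z)"
      unfolding pow_mat.simps(2) by (rule assoc_mult_mat_vec[OF pow_carrier_mat[OF B] B]) simp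
    then show ?case using w unfolding Bv by (intro exI[of _ w]) (simp add: mult.assoc)
  qed
  obtain i where i: "i < n" "0 < y i" using y(2) by blast
  let ?S = "\<Sum>j<n. c * y j"
  have bounded: "(\<mu> / r) ^ l * y i \<le> ?S" for l
  proof -
    obtain w where w: "?B ^\<^sub>m l *\<^sub>v ?v y = ?v w" "(\<mu> / r) ^ l * y i \<le> w i"
      using grow[of 1 y l] i by auto
    have Bl: "dim_row (?B ^\<^sub>m l) = n" "dim_col (?B ^\<^sub>m l) = n"
      using pow_carrier_mat[OF B] by (blast dest: carrier_matD)+
    have "w i \<le> cmod ((?B ^\<^sub>m l *\<^sub>v ?v y) $ i)" using w(1) i by simp
    also have "\<dots> = cmod (\<Sum>j<n. (?B ^\<^sub>m l) $$ (i, j) * y j)"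
      using i Bl by (simp add: scalar_prod_def atLeast0LessThan)
    also have "\<dots> \<le> (\<Sum>j<n. cmod ((?B ^\<^sub>m l) $$ (i, j) * y j))" by (rule norm_sum)
    also have "\<dots> \<le> ?S"
    proof (rule sum_mono)
      fix j assume "j \<in> {..<n}"
      then have "cmod ((?B ^\<^sub>m l) $$ (i, j)) \<le> c" "0 \<le> y j"
        using c[of l] Bl i y(1) by (auto simp: norm_bound_def)
      then show "cmod ((?B ^\<^sub>m l) $$ (i, j) * y j) \<le> c * y j"
        by (simp add: norm_mult mult_right_mono)
    qed
    finally show ?thesis using w(2) by linarith
  qed
  have "1 < \<mu> / r" using r r0 by simp
  then obtain l where "?S / y i < (\<mu> / r) ^ l" using real_arch_pow by blast
  then show False using bounded[of l] i(2) by (simp add: field_simps)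
qed

text \<open>Carried along the inverse of \<open>f\<close>, a subeigenvector of \<open>E\<close> is
  one of \<open>F\<close>: further edges of \<open>F\<close> only add nonnegative terms. Applied to
  an isomorphism this compares a graph with the extremal graph.\<close>

lemma rho_le_of_embedding:
  assumes E: "simple_graph n E" and F: "simple_graph n F" and n: "n > 0"
    and f: "inj_on f {0..<n}" "\<And>i. i < n \<Longrightarrow> f i < n" "\<And>i j. E i j \<Longrightarrow> F (f i) (f j)"
  shows "rho n E \<le> rho n F"
proof -
  obtain x :: "nat \<Rightarrow> real" where x: "\<And>i. 0 \<le> x i" "\<exists>i<n. 0 < x i"
    "\<And>i. i < n \<Longrightarrow> rho n E * x i \<le> (\<Sum>j\<in>{j. E i j}. x j)"
    by (rule rho_subeigenvector[OF E n]) blast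
  have bij: "bij_betw f {0..<n} {0..<n}"
    unfolding bij_betw_def using f(1,2) by (intro conjI endo_inj_surj) auto
  define g where "g = inv_into {0..<n} f"
  have gf: "g (f i) = i" if "i < n" for i
    using that f(1) by (simp add: g_def inv_into_f_f)
  have fg: "f (g i) = i" "g i < n" if "i < n" for i
    using that bij bij_betw_inv_into_right[OF bij] bij_betw_apply[OF bij_betw_inv_into[OF bij]]
    by (auto simp: g_def)
  show ?thesis
  proof (rule le_rho_of_subeigenvector[OF F, where y = "\<lambda>i. x (g i)"])
    show "\<exists>i<n. 0 < x (g i)" using x(2) f(2) gf by metis
    show "rho n E * x (g i) \<le> (\<Sum>j\<in>{j. F i j}. x (g j))" if i: "i < n" for i
    proof -
      have "rho n E * x (g i) \<le> (\<Sum>j\<in>{j. E (g i) j}. x j)" using x(3) fg i by blast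
      also have "\<dots> = (\<Sum>j\<in>f ` {j. E (g i) j}. x (g j))"
        using E gf f(1)
        by (subst sum.reindex) (auto simp: simple_graph_def inj_on_def intro!: sum.cong)
      also have "\<dots> \<le> (\<Sum>j\<in>{j. F i j}. x (g j))"
        using f(3) fg(1)[OF i] x(1) simple_graph_finite_nbrs[OF F]
        by (intro sum_mono2) (auto, metis)
      finally show ?thesis .
    qed
  qed (use x in auto)
qed

text \<open>The test vector is the indicator of \<open>K\<close>.\<close>

lemma clique_le_rho:
  assumes E: "simple_graph n E" and K: "K \<subseteq> {0..<n}" "K \<noteq> {}"
    and clique: "\<And>i j. i \<in> K \<Longrightarrow> j \<in> K \<Longrightarrow> i \<noteq> j \<Longrightarrow> E i j"
  shows "real (card K) - 1 \<le> rho n E"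
proof (rule le_rho_of_subeigenvector[OF E, where y = "\<lambda>i. if i \<in> K then 1 else 0"])
  fix i assume i: "i < n"
  have fin: "finite K" using K(1) finite_subset by blast
  have nn: "0 \<le> (\<Sum>j\<in>{j. E i j}. if j \<in> K then 1 else (0::real))" by (intro sum_nonneg) auto
  have "real (card K) - 1 \<le> (\<Sum>j\<in>{j. E i j}. if j \<in> K then 1 else 0)" if "i \<in> K"
  proof -
    have "real (card K) - 1 = (\<Sum>j\<in>K - {i}. if j \<in> K then 1 else 0)"
      using that fin K(2) by (simp add: of_nat_diff Suc_leI card_gt_0_iff)
    also have "\<dots> \<le> (\<Sum>j\<in>{j. E i j}. if j \<in> K then 1 else 0)"
      using that clique simple_graph_finite_nbrs[OF E] by (intro sum_mono2) auto
    finally show ?thesis .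
  qed
  then show "(real (card K) - 1) * (if i \<in> K then 1 else 0) \<le> (\<Sum>j\<in>{j. E i j}. if j \<in> K then 1 else 0)"
    using nn by simp
qed (use K in force)+

text \<open>Hong's bound, obtained from the row sums of the square of the adjacency matrix.\<close>
lemma rho_square_le_degree_sum:
  assumes E: "simple_graph n E" and n: "n > 0" and deg: "\<And>i. i < n \<Longrightarrow> 1 \<le> card {j. E i j}"
  shows "(rho n E)\<^sup>2 \<le> real (\<Sum>i<n. card {j. E i j}) - (real n - 1)"
proof -
  obtain x :: "nat \<Rightarrow> real" where x: "\<And>i. 0 \<le> x i" "\<exists>i<n. 0 < x i"
    "\<And>i. i < n \<Longrightarrow> rho n E * x i \<le> (\<Sum>j\<in>{j. E i j}. x j)"
    by (rule rho_subeigenvector[OF E n]) blast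
  \<comment> \<open>At a maximal entry \<open>x i\<close>, the value of the squared adjacency
    operator is at most \<open>x i\<close> times its row sum, and that row sum is the sum of the
    degrees of the neighbours of \<open>i\<close>.\<close>
  obtain i where "i \<in> {..<n}" "x i = Max (x ` {..<n})"
    using obtains_MAX[of "{..<n}" x] n by (metis finite_lessThan lessThan_empty_iff not_gr_zero)
  then have i: "i < n" "\<And>j. j < n \<Longrightarrow> x j \<le> x i" by auto
  have xi: "0 < x i" using x(2) i(2) by force
  let ?d = "\<lambda>i. card {j. E i j}"
  \<comment> \<open>The total degree consists of the degree of \<open>i\<close>, the degrees of its
    neighbours, and at least 1 for each of the \<open>n - 1 - ?d i\<close> other vertices;
    \<open>?d i\<close> cancels.\<close>
  have row: "(\<Sum>j\<in>{j. E i j}. real (?d j)) \<le> real (\<Sum>i<n. ?d i) - (real n - 1)"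
  proof -
    have sub: "{j. E i j} \<subseteq> {..<n} - {i}" using E by (auto simp: simple_graph_def)
    have "(\<Sum>i<n. ?d i) = ?d i + (\<Sum>j\<in>{..<n} - {i}. ?d j)"
      using i by (simp add: sum.remove)
    also have "(\<Sum>j\<in>{..<n} - {i}. ?d j) = (\<Sum>j\<in>{j. E i j}. ?d j) + (\<Sum>j\<in>{..<n} - {i} - {j. E i j}. ?d j)"
      using sub by (simp add: sum.subset_diff)
    finally have "(\<Sum>i<n. ?d i) = ?d i + ((\<Sum>j\<in>{j. E i j}. ?d j) + (\<Sum>j\<in>{..<n} - {i} - {j. E i j}. ?d j))" .
    moreover have "(\<Sum>j\<in>{..<n} - {i} - {j. E i j}. 1) \<le> (\<Sum>j\<in>{..<n} - {i} - {j. E i j}. ?d j)"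
      using deg by (intro sum_mono) auto
    moreover have "(\<Sum>j\<in>{..<n} - {i} - {j. E i j}. 1) = n - 1 - ?d i"
      using sub i by (simp add: card_Diff_subset finite_subset[OF sub])
    ultimately have "(\<Sum>j\<in>{j. E i j}. ?d j) + n \<le> (\<Sum>i<n. ?d i) + 1" by linarith
    then show ?thesis by (simp only: of_nat_sum[symmetric])
  qed
  have "(rho n E)\<^sup>2 * x i = rho n E * (rho n E * x i)" by (simp add: power2_eq_square)
  also have "\<dots> \<le> rho n E * (\<Sum>j\<in>{j. E i j}. x j)"
    using x(3) i rho_nonneg[OF n] by (intro mult_left_mono) auto
  also have "\<dots> = (\<Sum>j\<in>{j. E i j}. rho n E * x j)" by (rule sum_distrib_left)
  also have "\<dots> \<le> (\<Sum>j\<in>{j. E i j}. real (?d j) * x i)"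
  proof (rule sum_mono)
    fix j assume "j \<in> {j. E i j}"
    then have "j < n" using E by (auto simp: simple_graph_def)
    then have "rho n E * x j \<le> (\<Sum>l\<in>{l. E j l}. x l)" by (rule x(3))
    also have "\<dots> \<le> (\<Sum>l\<in>{l. E j l}. x i)"
      using E i(2) by (intro sum_mono) (auto simp: simple_graph_def)
    finally show "rho n E * x j \<le> real (?d j) * x i" by simp
  qed
  also have "\<dots> = (\<Sum>j\<in>{j. E i j}. real (?d j)) * x i" by (simp add: sum_distrib_right)
  also have "\<dots> \<le> (real (\<Sum>i<n. ?d i) - (real n - 1)) * x i"
    using row xi by (intro mult_right_mono) auto
  finally show ?thesis using xi by simp
qed

section \<open>Strict monotonicity of the spectral radius\<close>

text \<open>If the slack \<open>Z\<close> is positive at every vertex, \<open>\<mu>\<close> can be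
  raised a little. Otherwise the vector is changed so that fewer vertices have slack zero, which
  connectivity makes possible; hence the induction on their number.\<close>

lemma rho_gt_of_strict_subeigenvector:
  fixes x :: "nat \<Rightarrow> real"
  assumes F: "simple_graph n F" and conn: "connected_on {0..<n} F"
    and x: "\<And>i. i < n \<Longrightarrow> 0 \<le> x i" "\<exists>i<n. 0 < x i"
    and sub: "\<And>i. i < n \<Longrightarrow> \<mu> * x i \<le> (\<Sum>j\<in>{j. F i j}. x j)"
    and strict: "\<exists>i<n. \<mu> * x i < (\<Sum>j\<in>{j. F i j}. x j)"
  shows "\<mu> < rho n F"
proof -
  let ?S = "\<lambda>x i. \<Sum>j\<in>{j. F i j}. x j :: real"
  define Z where "Z = (\<lambda>x i. ?S x i - \<mu> * x i)"
  have lt: "j < n" if "F i j" for i j using that F by (auto simp: simple_graph_def)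
  have fin: "finite {j. F i j}" for i by (rule simple_graph_finite_nbrs[OF F])
  have main: "\<forall>x. (\<forall>i<n. 0 \<le> x i) \<longrightarrow> (\<exists>i<n. 0 < x i) \<longrightarrow> (\<forall>i<n. 0 \<le> Z x i) \<longrightarrow> (\<exists>i<n. 0 < Z x i) \<longrightarrow>
      card {i. i < n \<and> Z x i = 0} = c \<longrightarrow> \<mu> < rho n F" for c
  proof (induction c rule: less_induct)
    case (less c)
    show ?case
    proof (intro allI impI)
      fix x assume x: "\<forall>i<n. 0 \<le> x i" "\<exists>i<n. 0 < x i"
        and z: "\<forall>i<n. 0 \<le> Z x i" "\<exists>i<n. 0 < Z x i" and c: "card {i. i < n \<and> Z x i = 0} = c"
      show "\<mu> < rho n F"
      proof (cases "\<exists>i<n. Z x i = 0")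
        case False
        then have zpos: "\<And>i. i < n \<Longrightarrow> 0 < Z x i" using z(1) by (metis order_le_less)
        \<comment> \<open>The added 1 keeps the denominator positive where \<open>x i = 0\<close>;
          the quotient still guarantees \<open>e * x i \<le> Z x i\<close>.\<close>
        define e where "e = Min ((\<lambda>i. Z x i / (x i + 1)) ` {..<n})"
        have ne: "{..<n} \<noteq> {}" using x(2) by auto
        have "0 < e" unfolding e_def
          using ne zpos x(1) by (subst Min_gr_iff) (auto simp: add_nonneg_pos)
        have "\<mu> + e \<le> rho n F"
        proof (rule le_rho_of_subeigenvector[OF F])
          fix i assume i: "i < n"
          have "e \<le> Z x i / (x i + 1)" unfolding e_def using i by (intro Min_le) auto
          moreover have "0 \<le> x i" using x i by simp
          ultimately have "e * (x i + 1) \<le> Z x i" by (simp add: pos_le_divide_eq add_nonneg_pos)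
          then show "(\<mu> + e) * x i \<le> ?S x i"
            using \<open>0 < e\<close> by (simp add: Z_def algebra_simps)
        qed (use x in auto)
        then show ?thesis using \<open>0 < e\<close> by linarith
      next
        case True
        \<comment> \<open>Adding the neighbour sums to \<open>x\<close> makes the inequality strict at one more vertex.\<close>
        then obtain a where a: "a < n" "Z x a = 0" by blast
        obtain b where b: "b < n" "0 < Z x b" using z(2) by blast
        obtain i j where ij: "i < n" "j < n" "F i j" "Z x i = 0" "Z x j \<noteq> 0"
          using connected_on_crossing[OF conn, of a b "\<lambda>i. Z x i = 0"] a b
          by (metis atLeastLessThan_iff le0 less_numeral_extra(3))
        let ?x = "\<lambda>i. x i + ?S x i"
        \<comment> \<open>Taking slacks commutes with taking neighbour sums, so the new slack is the
          old one plus its own neighbour sum: positive slack spreads along edges.\<close>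
        have Zx: "Z ?x i = Z x i + ?S (Z x) i" for i
          by (simp add: Z_def sum.distrib sum_subtractf sum_distrib_left algebra_simps)
        have SZ: "0 \<le> ?S (Z x) i" for i using z(1) lt by (intro sum_nonneg) auto
        have Sx: "0 \<le> ?S x i" for i using x(1) lt by (intro sum_nonneg) auto
        have "0 < Z x j" using ij z(1) by (metis order_le_less)
        also have "Z x j \<le> ?S (Z x) i"
          using ij z(1) lt fin by (intro member_le_sum) auto
        finally have i': "Z ?x i \<noteq> 0" using ij(4) by (simp add: Zx)
        have "{i. i < n \<and> Z ?x i = 0} \<subseteq> {i. i < n \<and> Z x i = 0}"
          using z(1) SZ by (auto simp: Zx) (metis add_nonneg_eq_0_iff)
        then have "{i. i < n \<and> Z ?x i = 0} \<subset> {i. i < n \<and> Z x i = 0}"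
          using i' ij by blast
        then have lt_c: "card {i. i < n \<and> Z ?x i = 0} < c"
          unfolding c[symmetric] by (intro psubset_card_mono) auto
        have px: "\<forall>i<n. 0 \<le> ?x i" "\<exists>i<n. 0 < ?x i"
          using x Sx by (auto simp: add_pos_nonneg intro: add_nonneg_nonneg)
        have pz: "\<forall>i<n. 0 \<le> Z ?x i" "\<exists>i<n. 0 < Z ?x i"
          using z SZ unfolding Zx by (auto simp: add_pos_nonneg intro: add_nonneg_nonneg)
        show ?thesis by (rule less.IH[OF lt_c, THEN spec, THEN mp, THEN mp, THEN mp, THEN mp, THEN mp, OF px pz refl])
      qed
    qed
  qed
  have z: "\<forall>i<n. 0 \<le> Z x i" "\<exists>i<n. 0 < Z x i"
    using sub strict by (auto simp: Z_def)
  show ?thesis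
    by (rule main[THEN spec, THEN mp, THEN mp, THEN mp, THEN mp, THEN mp, OF _ x(2) z refl]) (use x(1) in blast)
qed

text \<open>A subeigenvector \<open>x\<close> of \<open>E\<close> serves for \<open>F\<close> as
  well, and it suffices to find one strict vertex. If there were none, a zero of \<open>x\<close>
  would force zeros at all its neighbours in \<open>F\<close>, so connectivity makes
  \<open>x\<close> positive everywhere; then the additional edge \<open>a b\<close> gives strictness
  at \<open>a\<close>.\<close>

lemma rho_strict_mono:
  assumes E: "simple_graph n E" and F: "simple_graph n F" and conn: "connected_on {0..<n} F"
    and sub: "\<And>i j. E i j \<Longrightarrow> F i j" and ne: "E \<noteq> F"
  shows "rho n E < rho n F"
proof -
  obtain a b where ab: "F a b" "\<not> E a b" using sub ne by blast
  then have a: "a < n" and b: "b < n" using F by (auto simp: simple_graph_def)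
  then have n: "n > 0" by simp
  obtain x :: "nat \<Rightarrow> real" where x: "\<And>i. 0 \<le> x i" "\<exists>i<n. 0 < x i"
    "\<And>i. i < n \<Longrightarrow> rho n E * x i \<le> (\<Sum>j\<in>{j. E i j}. x j)"
    by (rule rho_subeigenvector[OF E n]) blast
  have fin: "finite {j. F i j}" for i by (rule simple_graph_finite_nbrs[OF F])
  have mono: "(\<Sum>j\<in>{j. E i j}. x j) \<le> (\<Sum>j\<in>{j. F i j}. x j)" for i
    using sub fin x(1) by (intro sum_mono2) auto
  have le: "rho n E * x i \<le> (\<Sum>j\<in>{j. F i j}. x j)" if "i < n" for i
    using x(3)[OF that] mono[of i] by linarith
  show ?thesis
  proof (rule rho_gt_of_strict_subeigenvector[OF F conn _ x(2) le], safe)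
    show "\<exists>i<n. rho n E * x i < (\<Sum>j\<in>{j. F i j}. x j)"
    proof (rule ccontr)
      assume "\<not> ?thesis"
      then have eq: "(\<Sum>j\<in>{j. F i j}. x j) \<le> rho n E * x i" if "i < n" for i
        using that by (meson not_le)
      have pos: "0 < x i" if i: "i < n" for i
      proof (rule ccontr)
        assume "\<not> 0 < x i"
        then have "x i = 0" using x(1)[of i] by simp
        moreover obtain l where "l < n" "0 < x l" using x(2) by blast
        ultimately obtain p q where pq: "p < n" "q < n" "F p q" "x p = 0" "x q \<noteq> 0"
          using connected_on_crossing[OF conn, of i l "\<lambda>i. x i = 0"] i
          by (metis atLeastLessThan_iff le0 less_numeral_extra(3))
        have "x q \<le> (\<Sum>j\<in>{j. F p j}. x j)" using pq x(1) fin by (intro member_le_sum) auto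
        then show False using eq[OF pq(1)] pq(4,5) x(1)[of q] by simp
      qed
      have "(\<Sum>j\<in>{j. E a j}. x j) < (\<Sum>j\<in>{j. F a j}. x j)"
        using ab sub fin pos[OF b] x(1) by (intro sum_strict_mono2[of _ _ b]) auto
      then show False using eq[OF a] x(3)[OF a] by linarith
    qed
  qed (use x in auto)
qed

section \<open>Spanning trees of bounded degree\<close>

lemma connected_onI_root:
  assumes "symp E" "r \<in> V" and reach: "\<And>x. x \<in> V \<Longrightarrow> (\<lambda>x y. x \<in> V \<and> y \<in> V \<and> E x y)\<^sup>*\<^sup>* x r"
  shows "connected_on V E"
  unfolding connected_on_def
proof (intro ballI)
  let ?R = "\<lambda>x y. x \<in> V \<and> y \<in> V \<and> E x y"
  fix u v assume "u \<in> V" "v \<in> V"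
  have "symp ?R" using assms(1) by (auto simp: symp_def)
  then have "?R\<^sup>*\<^sup>* r v" using reach[OF \<open>v \<in> V\<close>] by (rule sympD[OF symp_rtranclp])
  then show "?R\<^sup>*\<^sup>* u v" using reach[OF \<open>u \<in> V\<close>] by (rule rtranclp_trans[rotated])
qed

text \<open>Edges that are not bridges can be deleted one by one without losing connectivity, and
  degrees only decrease. Later constructions therefore never have to verify acyclicity.\<close>

lemma has_spanning_k_treeI:
  assumes "simple_graph n T" "\<And>i j. T i j \<Longrightarrow> E i j" "connected_on {0..<n} T"
    "\<And>u. u < n \<Longrightarrow> card {v. T u v} \<le> k"
  shows "has_spanning_k_tree n E k"
  using assms
proof (induction "card {(x, y). T x y}" arbitrary: T rule: less_induct)
  case less
  define C where "C = (\<lambda>u v. connected_on {0..<n} (\<lambda>x y. T x y \<and> {x, y} \<noteq> {u, v}))"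
  show ?case
  proof (cases "\<exists>u v. T u v \<and> C u v")
    case False
    then have "\<forall>u v. T u v \<longrightarrow> \<not> C u v" by blast
    then have "spanning_tree n E T"
      unfolding spanning_tree_def C_def using less.prems(1-3) by (intro conjI) auto
    then show ?thesis using less.prems(4) unfolding has_spanning_k_tree_def by (intro exI[of _ T]) simp
  next
    case True
    then obtain u v where "T u v" "C u v" by blast
    then have uv: "T u v" "connected_on {0..<n} (\<lambda>x y. T x y \<and> {x, y} \<noteq> {u, v})"
      by (simp_all only: C_def)
    let ?T = "\<lambda>x y. T x y \<and> {x, y} \<noteq> {u, v}"
    have "finite {(x, y). T x y}"
      by (rule finite_subset[of _ "{0..<n} \<times> {0..<n}"])
        (use simple_graph_less[OF less.prems(1)] in auto)
    moreover have "{(x, y). ?T x y} \<subset> {(x, y). T x y}"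
    proof (rule psubsetI)
      have "(u, v) \<in> {(x, y). T x y} - {(x, y). ?T x y}" using uv(1) by simp
      then show "{(x, y). ?T x y} \<noteq> {(x, y). T x y}" by blast
    qed auto
    ultimately have less_card: "card {(x, y). ?T x y} < card {(x, y). T x y}"
      by (rule psubset_card_mono)
    show ?thesis
    proof (rule less.hyps[OF less_card _ _ uv(2)])
      show "simple_graph n ?T"
        using less.prems(1) unfolding simple_graph_def by (metis insert_commute)
      show "E i j" if "T i j \<and> {i, j} \<noteq> {u, v}" for i j using that less.prems(2) by blast
      show "card {v'. ?T u' v'} \<le> k" if "u' < n" for u'
        using less.prems(4)[OF that] simple_graph_finite_nbrs[OF less.prems(1), of u']
        by (elim order_trans[rotated]) (auto intro!: card_mono)
    qed
  qed
qed

text \<open>A rooted tree on \<open>A\<close>, given by its parent function \<open>p\<close>; the function \<open>d\<close> certifies that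
  following parents leads to the root \<open>r\<close>.\<close>
definition rooted_tree :: "nat set \<Rightarrow> nat \<Rightarrow> (nat \<Rightarrow> nat) \<Rightarrow> (nat \<Rightarrow> nat) \<Rightarrow> (nat \<Rightarrow> nat \<Rightarrow> bool) \<Rightarrow> bool" where
  "rooted_tree A r p d E \<longleftrightarrow> finite A \<and> r \<in> A \<and> d r = 0 \<and>
     (\<forall>x\<in>A - {r}. p x \<in> A \<and> E x (p x) \<and> d (p x) < d x)"

definition children :: "nat set \<Rightarrow> nat \<Rightarrow> (nat \<Rightarrow> nat) \<Rightarrow> nat \<Rightarrow> nat set" where
  "children A r p x = {c \<in> A - {r}. p c = x}"

text \<open>The vertices of full degree at which the tree cannot be relieved by re-hanging a child
  below the root.\<close>
definition blocked :: "nat set \<Rightarrow> nat \<Rightarrow> (nat \<Rightarrow> nat) \<Rightarrow> (nat \<Rightarrow> nat \<Rightarrow> bool) \<Rightarrow> nat \<Rightarrow> nat set" where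
  "blocked A r p E k =
     {x \<in> A - {r}. card (children A r p x) = k - 1 \<and> (\<forall>c \<in> children A r p x. \<not> E c r)}"

section \<open>Rooted trees and re-hanging\<close>

lemma finite_children: "finite A \<Longrightarrow> finite (children A r p x)"
  by (simp add: children_def)

lemma rooted_tree_connected:
  assumes tree: "rooted_tree A r p d E" and T: "symp T" "\<And>x. x \<in> A - {r} \<Longrightarrow> T x (p x)"
  shows "connected_on A T"
proof (rule connected_onI_root[OF T(1)])
  show "r \<in> A" using tree by (simp add: rooted_tree_def)
  fix x assume "x \<in> A"
  then show "(\<lambda>x y. x \<in> A \<and> y \<in> A \<and> T x y)\<^sup>*\<^sup>* x r"
  proof (induction "d x" arbitrary: x rule: less_induct)
    case less
    show ?case
    proof (cases "x = r")
      case False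
      then have px: "p x \<in> A" "d (p x) < d x"
        using tree less.prems by (auto simp: rooted_tree_def)
      have "(\<lambda>x y. x \<in> A \<and> y \<in> A \<and> T x y) x (p x)"
        using px(1) T(2)[of x] less.prems False by simp
      then show ?thesis using less.hyps[OF px(2,1)] by (rule converse_rtranclp_into_rtranclp)
    qed simp
  qed
qed

text \<open>\<open>d\<close> is the distance to \<open>r\<close>, and a parent is the next vertex on
  a shortest path.\<close>

lemma connected_imp_rooted_tree:
  assumes fin: "finite A" and conn: "connected_on A T" and r: "r \<in> A"
  shows "\<exists>p d. rooted_tree A r p d T"
proof -
  let ?R = "\<lambda>x y. x \<in> A \<and> y \<in> A \<and> T x y"
  define d where "d = (\<lambda>x. LEAST l. (?R ^^ l) x r)"
  have "\<exists>y. y \<in> A \<and> T x y \<and> d y < d x" if x: "x \<in> A - {r}" for x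
  proof -
    have "?R\<^sup>*\<^sup>* x r" using conn x r by (auto simp: connected_on_def)
    then have "\<exists>l. (?R ^^ l) x r" by (rule rtranclp_imp_relpowp)
    then have dx: "(?R ^^ d x) x r" unfolding d_def by (rule LeastI_ex)
    have "d x \<noteq> 0" using dx x by (intro notI) auto
    then obtain l where l: "d x = Suc l" using not0_implies_Suc by blast
    obtain y where y: "?R x y \<and> (?R ^^ l) y r"
      using relpowp_Suc_D2[OF dx[unfolded l]] by (rule exE)
    have "d y \<le> l" unfolding d_def using conjunct2[OF y] by (rule Least_le)
    then show ?thesis using y l by auto
  qed
  then obtain p where "\<forall>x\<in>A - {r}. p x \<in> A \<and> T x (p x) \<and> d (p x) < d x" by metis
  moreover have "d r = 0" unfolding d_def by (rule Least_equality) auto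
  ultimately show ?thesis using fin r by (auto simp: rooted_tree_def)
qed

text \<open>The parent is a neighbour too, and it is not a child because \<open>d\<close> decreases
  towards the root.\<close>

lemma card_children_less_degree:
  assumes tree: "rooted_tree A r p d T" and "symp T" and x: "x \<in> A - {r}" and fin: "finite {y. T x y}"
  shows "card (children A r p x) < card {y. T x y}"
proof (rule psubset_card_mono[OF fin])
  have sub: "children A r p x \<subseteq> {y. T x y}"
    using tree assms(2) by (auto simp: children_def rooted_tree_def dest: sympD)
  have "p x \<in> {y. T x y}" using tree x by (auto simp: rooted_tree_def)
  moreover have "p x \<notin> children A r p x"
  proof
    assume "p x \<in> children A r p x"
    then have ppx: "p x \<in> A - {r}" "p (p x) = x" by (auto simp: children_def)
    moreover have "d (p (p x)) < d (p x)" using tree ppx(1) unfolding rooted_tree_def by blast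
    moreover have "d (p x) < d x" using tree x by (auto simp: rooted_tree_def)
    ultimately show False by simp
  qed
  ultimately show "children A r p x \<subset> {y. T x y}" using sub by blast
qed

text \<open>Prepares \<open>x\<close> to receive one more edge. With at most \<open>k - 1\<close>
  children everywhere, the root has room for one more child, and only a non-root vertex with exactly
  \<open>k - 1\<close> children is full. Unless it is blocked, one of its children is adjacent to
  the root and can be hung there instead.\<close>

lemma rooted_tree_relieve:
  assumes tree: "rooted_tree A r p d E" and E: "symp E" and k: "k \<ge> 2"
    and ch: "\<forall>z\<in>A. card (children A r p z) \<le> k - 1"
    and x: "x \<in> A" "x \<notin> blocked A r p E k"
  obtains T where "symp T" "\<And>a b. T a b \<Longrightarrow> a \<in> A \<and> b \<in> A \<and> E a b" "connected_on A T"
    "\<And>z. z \<in> A \<Longrightarrow> card {y. T z y} \<le> k" "card {y. T x y} \<le> k - 1"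
proof -
  have fin: "finite A" and r: "r \<in> A" using tree by (auto simp: rooted_tree_def)
  \<comment> \<open>Apart from the root, a vertex also has the edge to its parent; hence
    \<open>k - 2\<close> children where the root may have \<open>k - 1\<close>.\<close>
  have "\<exists>q. rooted_tree A r q d E \<and> card (children A r q r) \<le> k \<and>
    (\<forall>z\<in>A - {r}. card (children A r q z) \<le> k - 1) \<and>
    card (children A r q x) \<le> (if x = r then k - 1 else k - 2)"
  proof (cases "x = r \<or> card (children A r p x) \<noteq> k - 1")
    case True
    then show ?thesis
      using tree ch x r by (intro exI[of _ p]) (force dest: le_neq_implies_less)
  next
    case False
    then obtain c where c: "c \<in> children A r p x" "E c r" and xr: "x \<noteq> r"
      and cx: "card (children A r p x) = k - 1"
      using x by (auto simp: blocked_def)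
    let ?q = "p(c := r)"
    have cA: "c \<in> A" "c \<noteq> r" "p c = x" using c by (auto simp: children_def)
    \<comment> \<open>So \<open>d c\<close> is positive, and since \<open>d r = 0\<close> the same
      \<open>d\<close> still certifies the tree after \<open>c\<close> is hung below
      \<open>r\<close>.\<close>
    have "d (p c) < d c" using tree cA by (auto simp: rooted_tree_def)
    then have q: "rooted_tree A r ?q d E"
      using tree c(2) by (auto simp: rooted_tree_def)
    have "card (children A r ?q r) \<le> card (insert c (children A r p r))"
      using finite_children[OF fin] by (intro card_mono) (auto simp: children_def)
    also have "\<dots> \<le> Suc (card (children A r p r))" by (rule card_insert_le_m1) auto
    also have "\<dots> \<le> k" using bspec[OF ch r] k by linarith
    finally have 1: "card (children A r ?q r) \<le> k" .
    have 2: "card (children A r ?q z) \<le> k - 1" if z: "z \<in> A - {r}" for z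
    proof -
      have "card (children A r ?q z) \<le> card (children A r p z)"
        using z finite_children[OF fin] by (intro card_mono) (auto simp: children_def split: if_splits)
      then show ?thesis using ch z by fastforce
    qed
    have "card (children A r ?q x) \<le> card (children A r p x - {c})"
      using xr finite_children[OF fin] by (intro card_mono) (auto simp: children_def split: if_splits)
    also have "\<dots> = k - 2" using c(1) cx by simp
    finally show ?thesis using q 1 2 xr by (intro exI[of _ ?q]) auto
  qed
  then obtain q where q: "rooted_tree A r q d E" "card (children A r q r) \<le> k"
    "\<And>z. z \<in> A - {r} \<Longrightarrow> card (children A r q z) \<le> k - 1"
    "card (children A r q x) \<le> (if x = r then k - 1 else k - 2)" by blast
  let ?T = "\<lambda>a b. (a \<in> A - {r} \<and> b = q a) \<or> (b \<in> A - {r} \<and> a = q b)"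
  have root: "{y. ?T r y} \<subseteq> children A r q r" by (auto simp: children_def)
  have rest: "{y. ?T z y} \<subseteq> insert (q z) (children A r q z)" for z by (auto simp: children_def)
  have deg_root: "card {y. ?T r y} \<le> card (children A r q r)"
    by (rule card_mono[OF finite_children[OF fin] root])
  have deg: "card {y. ?T z y} \<le> Suc (card (children A r q z))" for z
  proof -
    have "card {y. ?T z y} \<le> card (insert (q z) (children A r q z))"
      using finite_children[OF fin] rest by (intro card_mono) auto
    also have "\<dots> \<le> Suc (card (children A r q z))" by (rule card_insert_le_m1) auto
    finally show ?thesis .
  qed
  show thesis
  proof
    show sym: "symp ?T" by (auto simp: symp_def)
    show "a \<in> A \<and> b \<in> A \<and> E a b" if "?T a b" for a b
      using that q(1) sympD[OF E] by (auto simp: rooted_tree_def)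
    show "connected_on A ?T" by (rule rooted_tree_connected[OF q(1) sym]) auto
    show "card {y. ?T z y} \<le> k" if "z \<in> A" for z
    proof (cases "z = r")
      case True
      then show ?thesis using deg_root q(2) by simp
    next
      case False
      then have "Suc (card (children A r q z)) \<le> k" using q(3)[of z] that k by auto
      then show ?thesis using deg[of z] by linarith
    qed
    show "card {y. ?T x y} \<le> k - 1"
    proof (cases "x = r")
      case True
      then show ?thesis using deg_root q(4) by simp
    next
      case False
      then have "Suc (card (children A r q x)) \<le> k - 1" using q(4) k by auto
      then show ?thesis using deg[of x] by linarith
    qed
  qed
qed

text \<open>The root, its neighbours and the children of blocked vertices are disjoint parts of
  \<open>A\<close>: by definition such a child is neither the root nor adjacent to it. Distinct
  blocked vertices have disjoint sets of \<open>k - 1\<close> children.\<close>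

lemma card_root_nbrs_blocked:
  assumes tree: "rooted_tree A r p d E" and E: "symp E" "\<not> E r r"
  shows "card {y \<in> A. E r y} + (k - 1) * card (blocked A r p E k) + 1 \<le> card A"
proof -
  let ?W = "blocked A r p E k"
  let ?C = "\<Union>x\<in>?W. children A r p x"
  have fin: "finite A" and r: "r \<in> A" using tree by (auto simp: rooted_tree_def)
  have finW: "finite ?W" using fin by (simp add: blocked_def)
  have "card ?C = (\<Sum>x\<in>?W. card (children A r p x))"
    using finite_children[OF fin] finW by (intro card_UN_disjoint) (auto simp: children_def)
  also have "\<dots> = (k - 1) * card ?W" by (simp add: blocked_def)
  finally have cC: "card ?C = (k - 1) * card ?W" .
  have "card {y \<in> A. E r y} + card ?C + 1 = card (insert r ({y \<in> A. E r y} \<union> ?C))"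
  proof -
    have "r \<notin> {y \<in> A. E r y} \<union> ?C" using E by (auto simp: children_def)
    moreover have "{y \<in> A. E r y} \<inter> ?C = {}" using E(1) by (auto simp: blocked_def dest: sympD)
    ultimately show ?thesis
      using fin finW finite_children[OF fin] by (simp add: card_Un_disjoint)
  qed
  also have "\<dots> \<le> card A" using r fin by (intro card_mono) (auto simp: children_def)
  finally show ?thesis using cC by simp
qed

section \<open>Gluing trees, and the closure lemma\<close>

lemma connected_on_join:
  assumes A: "connected_on A T" and B: "connected_on B T" and x: "x \<in> A" and y: "y \<in> B"
    and T: "symp T" "T x y"
  shows "connected_on (A \<union> B) T"
proof (rule connected_onI_root[OF T(1)])
  let ?R = "\<lambda>V x y. x \<in> V \<and> y \<in> V \<and> T x y"
  show "x \<in> A \<union> B" using x by simp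
  have mono: "(?R (A \<union> B))\<^sup>*\<^sup>* a b" if "(?R V)\<^sup>*\<^sup>* a b" "V \<subseteq> A \<union> B" for a b V
    using that(1) by (rule rtranclp_mono[THEN predicate2D, rotated]) (use that(2) in auto)
  fix z assume "z \<in> A \<union> B"
  then show "(?R (A \<union> B))\<^sup>*\<^sup>* z x"
  proof
    assume "z \<in> A"
    then show ?thesis using A x by (intro mono[of A]) (auto simp: connected_on_def)
  next
    assume "z \<in> B"
    then have "(?R (A \<union> B))\<^sup>*\<^sup>* z y" using B y by (intro mono[of B]) (auto simp: connected_on_def)
    moreover have "?R (A \<union> B) y x" using x y T by (auto dest: sympD)
    ultimately show ?thesis by (rule rtranclp.rtrancl_into_rtrancl)
  qed
qed

lemma connected_on_mono:
  assumes "connected_on V T" "\<And>a b. a \<in> V \<Longrightarrow> b \<in> V \<Longrightarrow> T a b \<Longrightarrow> T' a b"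
  shows "connected_on V T'"
proof -
  have "(\<lambda>x y. x \<in> V \<and> y \<in> V \<and> T x y) \<le> (\<lambda>x y. x \<in> V \<and> y \<in> V \<and> T' x y)" using assms(2) by auto
  from rtranclp_mono[OF this] show ?thesis
    using assms(1) unfolding connected_on_def by blast
qed

lemma connected_on_component:
  assumes "symp T" "r \<in> V" and V: "\<And>a b. T a b \<Longrightarrow> a \<in> V \<and> b \<in> V"
  shows "connected_on {x \<in> V. T\<^sup>*\<^sup>* x r} T"
proof (rule connected_onI_root[OF assms(1)])
  let ?A = "{x \<in> V. T\<^sup>*\<^sup>* x r}"
  show "r \<in> ?A" using assms by simp
  fix x assume "x \<in> ?A"
  then have "T\<^sup>*\<^sup>* x r" by simp
  then show "(\<lambda>x y. x \<in> ?A \<and> y \<in> ?A \<and> T x y)\<^sup>*\<^sup>* x r"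
  proof (induction rule: converse_rtranclp_induct)
    case (step y z)
    have "y \<in> ?A \<and> z \<in> ?A \<and> T y z"
      using step.hyps V by (auto intro: converse_rtranclp_into_rtranclp)
    then show ?case using step.IH by (rule converse_rtranclp_into_rtranclp)
  qed simp
qed

text \<open>The closure lemma of Kano and Kishimoto. Deleting \<open>uv\<close> from a spanning \<open>k\<close>-tree of
  \<open>G + uv\<close> leaves trees rooted at \<open>u\<close> and \<open>v\<close>. An edge of \<open>G\<close> between them that avoids
  the blocked vertices would yield a spanning \<open>k\<close>-tree of \<open>G\<close>; so the blocked vertices separate
  \<open>u\<close> from \<open>v\<close>, there are at least \<open>m\<close> of them, and each has \<open>k - 1\<close> children that are not
  adjacent to the root of its tree.\<close>
lemma spanning_k_tree_closure:
  assumes E: "simple_graph n E" and k: "k \<ge> 2" and mc: "m_connected n E m"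
    and uv: "u < n" "v < n" "u \<noteq> v" "\<not> E u v"
    and plus: "has_spanning_k_tree n (\<lambda>x y. E x y \<or> {x, y} = {u, v}) k"
    and no: "\<not> has_spanning_k_tree n E k"
  shows "card {j. E u j} + card {j. E v j} + (k - 2) * m + 2 \<le> n"
proof -
  let ?V = "{0..<n}"
  have symE: "symp E" by (rule simple_graph_symp[OF E])
  obtain T where T: "simple_graph n T" "\<And>i j. T i j \<Longrightarrow> E i j \<or> {i, j} = {u, v}"
    "connected_on ?V T" "\<And>x. x < n \<Longrightarrow> card {y. T x y} \<le> k"
    using plus by (auto simp: has_spanning_k_tree_def spanning_tree_def)
  define T0 where "T0 = (\<lambda>x y. T x y \<and> {x, y} \<noteq> {u, v})"
  have T0: "simple_graph n T0"
    using T(1) unfolding simple_graph_def T0_def by (metis insert_commute)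
  have symT0: "symp T0" by (rule simple_graph_symp[OF T0])
  have T0V: "a \<in> ?V \<and> b \<in> ?V" if "T0 a b" for a b using simple_graph_less[OF T0 that] by simp
  have T0E: "E a b" if "T0 a b" for a b using that T(2) by (auto simp: T0_def)
  have finT: "finite {y. T x y}" for x by (rule simple_graph_finite_nbrs[OF T(1)])
  have finT0: "finite {y. T0 x y}" for x by (rule simple_graph_finite_nbrs[OF T0])
  have deg0: "card {y. T0 x y} \<le> k" if "x < n" for x
  proof -
    have "{y. T0 x y} \<subseteq> {y. T x y}" by (auto simp: T0_def)
    then show ?thesis using T(4)[OF that] card_mono[OF finT] order_trans by blast
  qed
  have nc: "\<not> connected_on ?V T0"
  proof
    assume conn: "connected_on ?V T0"
    have "has_spanning_k_tree n E k"
      by (rule has_spanning_k_treeI[OF T0]) (use T0E deg0 conn in auto)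
    with no show False by contradiction
  qed
  have Tuv: "T u v"
  proof (rule ccontr)
    assume "\<not> T u v"
    then have "\<not> T v u" using sympD[OF simple_graph_symp[OF T(1)]] by blast
    with \<open>\<not> T u v\<close> have "T0 = T" by (auto simp: T0_def fun_eq_iff doubleton_eq_iff)
    then show False using nc T(3) by simp
  qed
  then have Tvu: "T v u" by (rule sympD[OF simple_graph_symp[OF T(1)]])
  \<comment> \<open>The removed edge \<open>uv\<close> frees one place at both of its ends, so the
    bound of \<open>k - 1\<close> children will hold at the roots as well.\<close>
  have deg_root: "card {y. T0 w y} \<le> k - 1" if w: "w \<in> {u, v}" for w
  proof -
    define w' where "w' = (if w = u then v else u)"
    have w': "T w w'" "{w, w'} = {u, v}" using w Tuv Tvu by (auto simp: w'_def)
    have "card {y. T0 w y} \<le> card ({y. T w y} - {w'})"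
      using w' finT by (intro card_mono) (auto simp: T0_def)
    also have "\<dots> = card {y. T w y} - 1" using w' by (simp add: finT)
    also have "\<dots> \<le> k - 1" using T(4)[of w] w uv by auto
    finally show ?thesis .
  qed
  define A where "A = {x \<in> ?V. T0\<^sup>*\<^sup>* x u}"
  define B where "B = {x \<in> ?V. T0\<^sup>*\<^sup>* x v}"
  have uA: "u \<in> A" and vB: "v \<in> B" using uv by (auto simp: A_def B_def)
  have finA: "finite A" and finB: "finite B" by (auto simp: A_def B_def)
  have cA: "connected_on A T0" unfolding A_def
    by (rule connected_on_component[OF symT0]) (use uv T0V in auto)
  have cB: "connected_on B T0" unfolding B_def
    by (rule connected_on_component[OF symT0]) (use uv T0V in auto)
  \<comment> \<open>A walk in \<open>T\<close> towards \<open>u\<close> either stays in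
    \<open>T0\<close> or uses the edge \<open>uv\<close>, whose ends lie in \<open>A\<close> and
    \<open>B\<close>.\<close>
  have AB: "A \<union> B = ?V"
  proof
    show "?V \<subseteq> A \<union> B"
    proof
      fix x assume x: "x \<in> ?V"
      then have "(\<lambda>x y. x \<in> ?V \<and> y \<in> ?V \<and> T x y)\<^sup>*\<^sup>* x u"
        using T(3) uv by (simp add: connected_on_def)
      then show "x \<in> A \<union> B"
      proof (induction rule: converse_rtranclp_induct)
        case base
        then show ?case using uA by simp
      next
        case (step y z)
        show ?case
        proof (cases "{y, z} = {u, v}")
          case True
          then show ?thesis using uA vB by (auto simp: doubleton_eq_iff)
        next
          case False
          then have "T0 y z" using step.hyps by (simp add: T0_def)
          then show ?thesis using step.IH step.hyps
            by (auto simp: A_def B_def intro: converse_rtranclp_into_rtranclp)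
        qed
      qed
    qed
  qed (auto simp: A_def B_def)
  have disj: "A \<inter> B = {}"
  proof (rule ccontr)
    assume "A \<inter> B \<noteq> {}"
    then obtain w where "T0\<^sup>*\<^sup>* w u" "T0\<^sup>*\<^sup>* w v" by (auto simp: A_def B_def)
    then have "T0\<^sup>*\<^sup>* v u" using sympD[OF symp_rtranclp[OF symT0]] rtranclp_trans by metis
    then have "B \<subseteq> A" by (auto simp: A_def B_def)
    then have "A = ?V" using AB by blast
    then show False using cA nc by simp
  qed
  have tree_ex: "\<exists>p d. rooted_tree C r p d E \<and> (\<forall>x\<in>C. card (children C r p x) \<le> k - 1)"
    if C: "finite C" "connected_on C T0" "C \<subseteq> ?V" and r: "r \<in> C" "r \<in> {u, v}" for C r
  proof -
    obtain p d where pd: "rooted_tree C r p d T0"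
      using connected_imp_rooted_tree[OF C(1,2) r(1)] by blast
    have "card (children C r p x) \<le> k - 1" if x: "x \<in> C" for x
    proof (cases "x = r")
      case True
      have "children C r p r \<subseteq> {y. T0 r y}"
        using pd sympD[OF symT0] by (auto simp: children_def rooted_tree_def)
      then have "card (children C r p r) \<le> card {y. T0 r y}" using finT0 by (intro card_mono) auto
      then show ?thesis using deg_root[OF r(2)] True by simp
    next
      case False
      then have "card (children C r p x) < card {y. T0 x y}"
        using card_children_less_degree[OF pd symT0 _ finT0] x by auto
      then show ?thesis using deg0[of x] x C(3) by auto
    qed
    moreover have "rooted_tree C r p d E" using pd T0E by (auto simp: rooted_tree_def)
    ultimately show ?thesis by blast
  qed
  obtain p d where p: "rooted_tree A u p d E" "\<forall>x\<in>A. card (children A u p x) \<le> k - 1"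
    using tree_ex[OF finA cA _ uA] AB by auto
  obtain q e where q: "rooted_tree B v q e E" "\<forall>x\<in>B. card (children B v q x) \<le> k - 1"
    using tree_ex[OF finB cB _ vB] AB by auto
  define X where "X = blocked A u p E k"
  define Y where "Y = blocked B v q E k"
  have XA: "X \<subseteq> A - {u}" and YB: "Y \<subseteq> B - {v}" by (auto simp: X_def Y_def blocked_def)
  \<comment> \<open>Otherwise both trees could be relieved, one at \<open>x\<close> and the other at
    \<open>y\<close>, and joined by the edge \<open>x y\<close> without exceeding degree
    \<open>k\<close>.\<close>
  have cover: "x \<in> X \<or> y \<in> Y" if xy: "x \<in> A" "y \<in> B" "E x y" for x y
  proof (rule ccontr)
    assume "\<not> ?thesis"
    then have x: "x \<notin> blocked A u p E k" and y: "y \<notin> blocked B v q E k"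
      by (auto simp: X_def Y_def)
    obtain S where S: "symp S" "\<And>a b. S a b \<Longrightarrow> a \<in> A \<and> b \<in> A \<and> E a b" "connected_on A S"
      "\<And>z. z \<in> A \<Longrightarrow> card {y. S z y} \<le> k" "card {y. S x y} \<le> k - 1"
      by (rule rooted_tree_relieve[OF p(1) symE k p(2) xy(1) x]) blast+
    obtain U where U: "symp U" "\<And>a b. U a b \<Longrightarrow> a \<in> B \<and> b \<in> B \<and> E a b" "connected_on B U"
      "\<And>z. z \<in> B \<Longrightarrow> card {y. U z y} \<le> k" "card {z. U y z} \<le> k - 1"
      by (rule rooted_tree_relieve[OF q(1) symE k q(2) xy(2) y]) blast+
    let ?S = "\<lambda>a b. S a b \<or> U a b \<or> {a, b} = {x, y}"
    have symS: "symp ?S" using S(1) U(1) by (auto simp: symp_def insert_commute)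
    have SE: "E a b" if "?S a b" for a b
      using that S(2) U(2) xy(3) symE by (auto simp: doubleton_eq_iff dest: sympD)
    have "has_spanning_k_tree n E k"
    proof (rule has_spanning_k_treeI[where T = ?S])
      show "simple_graph n ?S"
        unfolding simple_graph_def
      proof (intro allI impI)
        fix a b assume ab: "?S a b"
        have "a < n" "b < n" "a \<noteq> b"
          using SE[OF ab] simple_graph_less[OF E] simple_graph_irrefl[OF E] by blast+
        then show "a < n \<and> b < n \<and> a \<noteq> b \<and> ?S b a" using sympD[OF symS ab] by (intro conjI)
      qed
      show "connected_on ?V ?S" unfolding AB[symmetric]
      proof (rule connected_on_join[OF _ _ xy(1,2) symS])
        show "connected_on A ?S" by (rule connected_on_mono[OF S(3)]) simp
        show "connected_on B ?S" by (rule connected_on_mono[OF U(3)]) simp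
      qed simp
      show "card {b. ?S a b} \<le> k" if "a < n" for a
      proof -
        have "a \<in> A \<or> a \<in> B" using that AB by auto
        then show ?thesis
        proof
          assume a: "a \<in> A"
          have aB: "a \<notin> B" using a disj by blast
          have fin: "finite {b. S a b}" using S(2) by (intro finite_subset[OF _ finA]) auto
          show ?thesis
          proof (cases "a = x")
            case True
            have "{b. ?S a b} \<subseteq> insert y {b. S x b}"
              using True aB U(2) by (auto simp: doubleton_eq_iff)
            then have "card {b. ?S a b} \<le> card (insert y {b. S x b})"
              using fin True by (intro card_mono) auto
            also have "\<dots> \<le> Suc (card {b. S x b})" by (rule card_insert_le_m1) auto
            finally show ?thesis using S(5) k by linarith
          next
            case False
            have "{b. ?S a b} \<subseteq> {b. S a b}"
              using False aB U(2) xy(2) by (auto simp: doubleton_eq_iff)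
            then show ?thesis using S(4)[OF a] card_mono[OF fin] order_trans by blast
          qed
        next
          assume a: "a \<in> B"
          have aA: "a \<notin> A" using a disj by blast
          have fin: "finite {b. U a b}" using U(2) by (intro finite_subset[OF _ finB]) auto
          show ?thesis
          proof (cases "a = y")
            case True
            have "{b. ?S a b} \<subseteq> insert x {b. U y b}"
              using True aA S(2) by (auto simp: doubleton_eq_iff)
            then have "card {b. ?S a b} \<le> card (insert x {b. U y b})"
              using fin True by (intro card_mono) auto
            also have "\<dots> \<le> Suc (card {b. U y b})" by (rule card_insert_le_m1) auto
            finally show ?thesis using U(5) k by linarith
          next
            case False
            have "{b. ?S a b} \<subseteq> {b. U a b}"
              using False aA S(2) xy(1) by (auto simp: doubleton_eq_iff)
            then show ?thesis using U(4)[OF a] card_mono[OF fin] order_trans by blast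
          qed
        qed
      qed
    qed (use SE in blast)
    then show False using no by simp
  qed
  have finX: "finite X" and finY: "finite Y" using XA YB finA finB by (auto intro: finite_subset)
  have "card (X \<union> Y) = card X + card Y"
    using finX finY XA YB disj by (intro card_Un_disjoint) auto
  \<comment> \<open>Roots are never blocked, so \<open>u\<close> and \<open>v\<close> survive the
    deletion of \<open>X \<union> Y\<close>; by \<open>cover\<close> no remaining edge leads from
    \<open>A\<close> to \<open>B\<close>.\<close>
  moreover have "m \<le> card (X \<union> Y)"
  proof (rule ccontr)
    assume "\<not> m \<le> card (X \<union> Y)"
    moreover have "X \<union> Y \<subseteq> ?V" using XA YB AB by blast
    ultimately have conn: "connected_on (?V - (X \<union> Y)) E" using mc by (simp add: m_connected_def)
    have "u \<in> ?V - (X \<union> Y)" "v \<in> ?V - (X \<union> Y)" "u \<in> A" "v \<notin> A"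
      using uA vB XA YB disj uv by auto
    then obtain i j where "i \<in> ?V - (X \<union> Y)" "j \<in> ?V - (X \<union> Y)" "E i j" "i \<in> A" "j \<notin> A"
      by (rule connected_on_crossing[OF conn, of u v "\<lambda>x. x \<in> A"]) blast
    then show False using cover[of i j] AB by blast
  qed
  ultimately have mXY: "m \<le> card X + card Y" by simp
  have split: "card {j. E w j} = card {j \<in> A. E w j} + card {j \<in> B. E w j}" for w
  proof -
    have "{j. E w j} = {j \<in> A. E w j} \<union> {j \<in> B. E w j}"
      using AB simple_graph_less[OF E] by auto
    then have "card {j. E w j} = card ({j \<in> A. E w j} \<union> {j \<in> B. E w j})" by (rule arg_cong)
    also have "\<dots> = card {j \<in> A. E w j} + card {j \<in> B. E w j}"
      using finA finB disj by (intro card_Un_disjoint) auto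
    finally show ?thesis .
  qed
  have "{j \<in> A. E v j} \<subseteq> X" using cover[OF _ vB] YB symE by (auto dest: sympD)
  then have vX: "card {j \<in> A. E v j} \<le> card X" using finX by (rule card_mono[rotated])
  have "{j \<in> B. E u j} \<subseteq> Y" using cover[OF uA] XA by auto
  then have uY: "card {j \<in> B. E u j} \<le> card Y" using finY by (rule card_mono[rotated])
  have irr: "\<not> E w w" for w by (rule simple_graph_irrefl[OF E])
  have uA': "card {j \<in> A. E u j} + (k - 1) * card X + 1 \<le> card A"
    unfolding X_def by (rule card_root_nbrs_blocked[OF p(1) symE irr])
  have vB': "card {j \<in> B. E v j} + (k - 1) * card Y + 1 \<le> card B"
    unfolding Y_def by (rule card_root_nbrs_blocked[OF q(1) symE irr])
  have "card A + card B = n" using card_Un_disjoint[OF finA finB disj] AB by simp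
  \<comment> \<open>Of the \<open>k - 1\<close> children counted for each blocked vertex, one pays
    for the neighbours of \<open>u\<close> in \<open>B\<close> and of \<open>v\<close> in
    \<open>A\<close>, which number at most \<open>card Y\<close> and \<open>card X\<close>. The
    other \<open>k - 2\<close> yield the term \<open>(k - 2) * m\<close>.\<close>
  moreover have k1: "k - 1 = Suc (k - 2)" using k by simp
  have "(k - 1) * w = (k - 2) * w + w" for w unfolding k1 by simp
  note this[of "card X"] this[of "card Y"]
  moreover have "(k - 2) * m \<le> (k - 2) * card X + (k - 2) * card Y"
    using mult_le_mono2[OF mXY, of "k - 2"] by (simp add: algebra_simps)
  ultimately show ?thesis using split[of u] split[of v] vX uY uA' vB' by linarith
qed

section \<open>Graphs closed under the degree condition\<close>

text \<open>A convex quadratic lies below its chord, by exactly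
  \<open>c * (a - l) * (u - a)\<close>.\<close>

lemma quadratic_neg_between:
  fixes a :: real
  assumes "c \<ge> 0" "l \<le> a" "a \<le> u" "c * l\<^sup>2 + p * l + q < 0" "c * u\<^sup>2 + p * u + q < 0"
  shows "c * a\<^sup>2 + p * a + q < 0"
proof (cases "l = u")
  case True
  then show ?thesis using assms by simp
next
  case False
  then have lu: "0 < u - l" using assms by simp
  have "(u - l) * (c * a\<^sup>2 + p * a + q) = (u - a) * (c * l\<^sup>2 + p * l + q)
      + (a - l) * (c * u\<^sup>2 + p * u + q) - c * ((a - l) * (u - a)) * (u - l)"
    by (simp add: power2_eq_square algebra_simps)
  moreover have "0 \<le> c * ((a - l) * (u - a)) * (u - l)" using assms lu by simp
  moreover have "(u - a) * (c * l\<^sup>2 + p * l + q) + (a - l) * (c * u\<^sup>2 + p * u + q) < 0"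
  proof (cases "a = l")
    case True
    then show ?thesis using assms(4) lu by (simp add: mult_pos_neg)
  next
    case False
    then have "(a - l) * (c * u\<^sup>2 + p * u + q) < 0" using assms by (intro mult_pos_neg) auto
    moreover have "(u - a) * (c * l\<^sup>2 + p * l + q) \<le> 0"
      using assms by (intro mult_nonneg_nonpos) auto
    ultimately show ?thesis by linarith
  qed
  ultimately have "(u - l) * (c * a\<^sup>2 + p * a + q) < 0" by linarith
  then show ?thesis using lu by (simp add: mult_less_0_iff)
qed

text \<open>The two upper bounds on the degree sum \<open>D\<close> agree to leading order at \<open>w = (n - s) / 2\<close>; below
  that point the second one contradicts the lower bound, above it the first one does, by
  convexity in \<open>w\<close>.\<close>
lemma clique_size_bound:
  fixes n t s m w D :: real
  assumes t: "t = s + m + 1" and m: "1 \<le> m" and s: "0 \<le> s" and w: "w \<le> n - t - 1"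
    and n: "7 * t + 5 * m - 3 \<le> n" "t * m + m + 3 * t / 2 + 3 \<le> n"
    and lower: "(n - t - 1)\<^sup>2 + n - 1 \<le> D"
    and upper: "D \<le> w * (w - 1) + 2 * ((n - w) * (n - 1 - s - w))"
      "D \<le> w * (n - 1) + (n - w) * ((n - 2 - s) / 2)"
  shows False
proof -
  \<comment> \<open>The left side is the second upper bound evaluated at
    \<open>w = (n - s) / 2\<close>.\<close>
  have mid: "3 * n\<^sup>2 / 4 - n - n * s / 2 - s\<^sup>2 / 4 < (n - t - 1)\<^sup>2 + n - 1"
  proof -
    have eq: "(n - t - 1)\<^sup>2 + n - 1 - (3 * n\<^sup>2 / 4 - n - n * s / 2 - s\<^sup>2 / 4)
        = n / 4 * (n - 8 * t + 2 * s) + ((t + 1)\<^sup>2 - 1) + s\<^sup>2 / 4"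
      by (simp add: power2_eq_square field_simps)
    \<comment> \<open>The first bound on \<open>n\<close> is used here:
      \<open>8t - 2s \<le> 7t + 5m - 3\<close>, because \<open>t = s + m + 1\<close> and
      \<open>m \<ge> 1\<close>.\<close>
    have "0 \<le> n / 4 * (n - 8 * t + 2 * s)" using assms(1-5) by (intro mult_nonneg_nonneg) auto
    moreover have "1\<^sup>2 < (t + 1)\<^sup>2" using t m s by (intro power_strict_mono) auto
    ultimately have "0 < n / 4 * (n - 8 * t + 2 * s) + ((t + 1)\<^sup>2 - 1) + s\<^sup>2 / 4"
      by (simp add: add_nonneg_pos add_pos_nonneg)
    then show ?thesis using eq by linarith
  qed
  have n0: "0 < n" using assms(1-5) by linarith
  show False
  proof (cases "w \<le> (n - s) / 2")
    case True
    have "D \<le> w * ((n + s) / 2) + n * (n - 2 - s) / 2"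
      using upper(2) by (simp add: field_simps)
    also have "\<dots> \<le> (n - s) / 2 * ((n + s) / 2) + n * (n - 2 - s) / 2"
      using True n0 s by (intro add_right_mono mult_right_mono) auto
    also have "\<dots> = 3 * n\<^sup>2 / 4 - n - n * s / 2 - s\<^sup>2 / 4"
      by (simp add: power2_eq_square field_simps)
    finally show False using mid lower by linarith
  next
    case False
    \<comment> \<open>The quadratic is taken in \<open>a = n - w\<close>, which ranges from
      \<open>t + 1\<close> to \<open>(n + s) / 2\<close>.\<close>
    define p where "p = 1 - 2 * n - 2 * (1 + s)"
    define q where "q = n * (n - 1) - ((n - t - 1)\<^sup>2 + n - 1)"
    have Q: "(n - a) * (n - a - 1) + 2 * (a * (a - 1 - s)) - ((n - t - 1)\<^sup>2 + n - 1)
        = 3 * a\<^sup>2 + p * a + q" for a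
      by (simp add: p_def q_def power2_eq_square algebra_simps)
    have "3 * (n - w)\<^sup>2 + p * (n - w) + q < 0"
    proof (rule quadratic_neg_between[of 3 "t + 1" _ "(n + s) / 2"])
      \<comment> \<open>At \<open>a = t + 1\<close> the terms in \<open>n^2\<close> and
        \<open>n * (t + 1)\<close> cancel. What remains is linear in \<open>n\<close>, and its sign
        is decided by the second bound on \<open>n\<close>.\<close>
      define b where "b = t * m + m + 3 * t / 2 + 3"
      have "3 * (t + 1)\<^sup>2 + p * (t + 1) + q = 2 * (b - n) - 2"
        unfolding b_def p_def q_def t by (simp add: power2_eq_square field_simps)
      moreover have "b \<le> n" using n(2) by (simp only: b_def)
      ultimately show "3 * (t + 1)\<^sup>2 + p * (t + 1) + q < 0" by simp
      \<comment> \<open>Here the first upper bound is smaller than the second by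
        \<open>(n + s) / 2\<close>, so \<open>mid\<close> applies again.\<close>
      have "3 * ((n + s) / 2)\<^sup>2 + p * ((n + s) / 2) + q
          = 3 * n\<^sup>2 / 4 - n * s / 2 - s\<^sup>2 / 4 - 3 * n / 2 - s / 2 - ((n - t - 1)\<^sup>2 + n - 1)"
        unfolding p_def q_def by (simp add: power2_eq_square field_simps)
      then show "3 * ((n + s) / 2)\<^sup>2 + p * ((n + s) / 2) + q < 0" using mid n0 s by linarith
    qed (use w False in \<open>auto simp: field_simps\<close>)
    then have "w * (w - 1) + 2 * ((n - w) * (n - w - 1 - s)) < (n - t - 1)\<^sup>2 + n - 1"
      unfolding Q[symmetric] by (simp add: algebra_simps)
    moreover have "n - w - 1 - s = n - 1 - s - w" by simp
    ultimately show False using upper(1) lower by simp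
  qed
qed

section \<open>Minimum degree, complete graphs and recognition of the extremal graph\<close>

lemma m_connected_mono:
  assumes "m_connected n E m" "\<And>i j. E i j \<Longrightarrow> F i j"
  shows "m_connected n F m"
  using assms connected_on_mono unfolding m_connected_def by metis

text \<open>Deleting the neighbours of \<open>v\<close> isolates it, and with fewer than
  \<open>m < n\<close> of them another vertex is left.\<close>

lemma m_connected_min_degree:
  assumes E: "simple_graph n E" and mc: "m_connected n E m" and v: "v < n"
  shows "m \<le> card {j. E v j}"
proof (rule ccontr)
  assume deg: "\<not> m \<le> card {j. E v j}"
  have N: "{j. E v j} \<subseteq> {0..<n}" using simple_graph_less[OF E] by auto
  then have conn: "connected_on ({0..<n} - {j. E v j}) E"
    using mc deg by (simp add: m_connected_def)
  have "card (insert v {j. E v j}) \<le> Suc (card {j. E v j})" by (rule card_insert_le_m1) auto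
  also have "\<dots> < card {0..<n}" using deg mc by (simp add: m_connected_def)
  finally have "\<not> {0..<n} \<subseteq> insert v {j. E v j}"
    using simple_graph_finite_nbrs[OF E, of v] by (meson card_mono finite_insert not_le)
  then obtain w where w: "w \<in> {0..<n} - {j. E v j}" "w \<noteq> v" by blast
  have "v \<in> {0..<n} - {j. E v j}" using v simple_graph_irrefl[OF E] by simp
  then obtain i j where "j \<in> {0..<n} - {j. E v j}" "E i j" "i = v"
    using connected_on_crossing[OF conn _ w(1), of v "\<lambda>x. x = v"] w(2) by blast
  then show False by simp
qed

text \<open>A Hamiltonian path has maximum degree at most 2.\<close>

lemma complete_has_spanning_k_tree:
  assumes "k \<ge> 2" and complete: "\<And>i j. i < n \<Longrightarrow> j < n \<Longrightarrow> i \<noteq> j \<Longrightarrow> E i j"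
  shows "has_spanning_k_tree n E k"
proof (cases "n = 0")
  case True
  then show ?thesis
    by (intro has_spanning_k_treeI[where T = "\<lambda>_ _. False"]) (auto simp: simple_graph_def connected_on_def)
next
  case False
  let ?T = "\<lambda>i j. i < n \<and> j < n \<and> (j = Suc i \<or> i = Suc j)"
  show ?thesis
  proof (rule has_spanning_k_treeI[where T = ?T])
    show "simple_graph n ?T" by (auto simp: simple_graph_def)
    have "rooted_tree {0..<n} 0 (\<lambda>i. i - 1) id ?T" using False by (auto simp: rooted_tree_def)
    then show "connected_on {0..<n} ?T"
      by (rule rooted_tree_connected) (auto simp: symp_def)
    show "card {j. ?T i j} \<le> k" for i
    proof -
      \<comment> \<open>At \<open>i = 0\<close> truncated subtraction puts \<open>0\<close> itself
        into the set; this is harmless for an upper bound.\<close>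
      have "card {j. ?T i j} \<le> card {Suc i, i - 1}" by (intro card_mono) auto
      also have "\<dots> \<le> k" using assms(1) card_insert_le_m1[of 2 "{i - 1}" "Suc i"] by simp
      finally show ?thesis .
    qed
  qed (use complete in auto)
qed

text \<open>The isomorphism glues bijections of \<open>A\<close>, \<open>K - A\<close> and the
  complement of \<open>K\<close> onto consecutive intervals of lengths \<open>m\<close>,
  \<open>card K - m\<close> and \<open>n - card K\<close>, the three blocks of the extremal
  graph.\<close>

lemma graph_iso_extremal_graphI:
  assumes G: "simple_graph n G" and n: "k * m + 1 \<le> n" and k: "k \<ge> 1"
    and K: "K \<subseteq> {0..<n}" "card K + (k - 1) * m + 1 = n" and A: "A \<subseteq> K" "card A = m"
    and iff: "\<And>i j. i < n \<Longrightarrow> j < n \<Longrightarrow> i \<noteq> j \<Longrightarrow> G i j \<longleftrightarrow> i \<in> A \<or> j \<in> A \<or> (i \<in> K \<and> j \<in> K)"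
  shows "graph_iso n G (extremal_graph n k m)"
proof -
  define c where "c = card K"
  have "k * m = (k - 1) * m + m" using k by (cases k) auto
  then have c: "m + (n - k * m - 1) = c" using n K(2) by (simp add: c_def)
  have mc: "m \<le> c" "c \<le> n" using c K(2) by (auto simp: c_def)
  have fin: "finite K" "finite A" using K(1) A(1) by (meson finite_subset finite_atLeastLessThan)+
  obtain f1 where f1: "bij_betw f1 A {0..<m}"
    using finite_same_card_bij[of A "{0..<m}"] fin A(2) by auto
  obtain f2 where f2: "bij_betw f2 (K - A) {m..<c}"
    using finite_same_card_bij[of "K - A" "{m..<c}"] fin A by (auto simp: card_Diff_subset c_def)
  obtain f3 where f3: "bij_betw f3 ({0..<n} - K) {c..<n}"
    using finite_same_card_bij[of "{0..<n} - K" "{c..<n}"] fin K(1) by (auto simp: card_Diff_subset c_def)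
  define g where "g = (\<lambda>x. if x \<in> A then f1 x else f2 x)"
  define f where "f = (\<lambda>x. if x \<in> K then g x else f3 x)"
  have "bij_betw g (A \<union> (K - A)) ({0..<m} \<union> {m..<c})"
    unfolding g_def by (rule bij_betw_disjoint_Un[OF f1 f2]) auto
  moreover have "A \<union> (K - A) = K" "{0..<m} \<union> {m..<c} = {0..<c}" using A(1) mc by auto
  ultimately have g: "bij_betw g K {0..<c}" by simp
  have "bij_betw f (K \<union> ({0..<n} - K)) ({0..<c} \<union> {c..<n})"
    unfolding f_def by (rule bij_betw_disjoint_Un[OF g f3]) auto
  moreover have "K \<union> ({0..<n} - K) = {0..<n}" "{0..<c} \<union> {c..<n} = {0..<n}" using K(1) mc by auto
  ultimately have f: "bij_betw f {0..<n} {0..<n}" by simp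
  have fK: "f i < c \<longleftrightarrow> i \<in> K" if "i < n" for i
    using that bij_betwE[OF g] bij_betwE[OF f3] by (force simp: f_def not_less)
  have fA: "f i < m \<longleftrightarrow> i \<in> A" if "i < n" for i
  proof -
    have "i \<in> A \<Longrightarrow> f i < m" using bij_betwE[OF f1] A(1) by (auto simp: f_def g_def)
    moreover have "i \<in> K - A \<Longrightarrow> m \<le> f i" using bij_betwE[OF f2] by (auto simp: f_def g_def)
    moreover have "i \<notin> K \<Longrightarrow> m \<le> f i" using fK[OF that] mc by linarith
    ultimately show ?thesis using A(1) by (meson DiffI not_le)
  qed
  have "G i j \<longleftrightarrow> extremal_graph n k m (f i) (f j)" if ij: "i < n" "j < n" for i j
  proof (cases "i = j")
    case True
    then show ?thesis using simple_graph_irrefl[OF G] by (simp add: extremal_graph_def)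
  next
    case False
    have "f i < n" "f j < n" using bij_betwE[OF f] ij by auto
    moreover have "f i \<noteq> f j" using f ij False by (auto simp: bij_betw_def inj_on_def)
    ultimately show ?thesis
      using iff[OF ij False] fA[OF ij(1)] fA[OF ij(2)] fK[OF ij(1)] fK[OF ij(2)]
      unfolding extremal_graph_def c by simp
  qed
  then show ?thesis using f unfolding graph_iso_def by (intro exI[of _ f]) simp
qed

text \<open>A clique vertex has \<open>card K - 1\<close> neighbours inside \<open>K\<close>. The
  edges leaving \<open>K\<close>, counted from their outer ends, number at most the sum of the
  outside degrees, which thus enters twice.\<close>

lemma sum_card_clique_le:
  assumes G: "simple_graph n G" and K: "K \<subseteq> {0..<n}"
  shows "(\<Sum>i<n. card {j. G i j}) \<le> card K * (card K - 1) + 2 * (\<Sum>v\<in>{0..<n} - K. card {j. G v j})"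
proof -
  let ?d = "\<lambda>i. card {j. G i j}"
  have finK: "finite K" using K finite_subset by blast
  have d: "?d u \<le> card K - 1 + card {j \<in> {0..<n} - K. G u j}" if u: "u \<in> K" for u
  proof -
    have "{j. G u j} \<subseteq> (K - {u}) \<union> {j \<in> {0..<n} - K. G u j}"
      using simple_graph_less[OF G] simple_graph_irrefl[OF G] by auto
    then have "?d u \<le> card ((K - {u}) \<union> {j \<in> {0..<n} - K. G u j})"
      using finK by (intro card_mono) auto
    also have "\<dots> \<le> card (K - {u}) + card {j \<in> {0..<n} - K. G u j}" by (rule card_Un_le)
    finally show ?thesis using u by simp
  qed
  have swap: "(\<Sum>u\<in>K. card {j \<in> {0..<n} - K. G u j}) = (\<Sum>j\<in>{0..<n} - K. card {u \<in> K. G u j})"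
    using sum.swap_restrict[of K "{0..<n} - K" "\<lambda>_ _. 1::nat" G] finK by (simp only: card_eq_sum finite_Diff finite_atLeastLessThan)
  have d_rev: "card {u \<in> K. G u j} \<le> ?d j" for j
    using simple_graph_finite_nbrs[OF G] sympD[OF simple_graph_symp[OF G]] by (intro card_mono) auto
  have "(\<Sum>i<n. ?d i) = (\<Sum>v\<in>{0..<n} - K. ?d v) + (\<Sum>u\<in>K. ?d u)"
    using sum.subset_diff[OF K, of ?d] by (simp add: atLeast0LessThan)
  also have "(\<Sum>u\<in>K. ?d u) \<le> (\<Sum>u\<in>K. card K - 1 + card {j \<in> {0..<n} - K. G u j})"
    using d by (rule sum_mono)
  also have "\<dots> = card K * (card K - 1) + (\<Sum>j\<in>{0..<n} - K. card {u \<in> K. G u j})"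
    by (simp only: sum.distrib sum_constant swap of_nat_id)
  also have "(\<Sum>j\<in>{0..<n} - K. card {u \<in> K. G u j}) \<le> (\<Sum>j\<in>{0..<n} - K. ?d j)"
    using d_rev by (intro sum_mono)
  finally show ?thesis by simp
qed

lemma closed_graph_is_extremal:
  fixes n m k :: nat
  assumes G: "simple_graph n G" and k: "k \<ge> 2" and m: "m \<ge> 1" and mc: "m_connected n G m"
    and no: "\<not> has_spanning_k_tree n G k"
    and closed: "\<And>u v. u < n \<Longrightarrow> v < n \<Longrightarrow> u \<noteq> v \<Longrightarrow> \<not> G u v \<Longrightarrow>
      card {j. G u j} + card {j. G v j} + (k - 2) * m + 2 \<le> n"
    and t: "t = (k - 1) * m + 1"
    and n: "7 * real t + 5 * real m - 3 \<le> real n"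
      "real t * real m + real m + 3 * real t / 2 + 3 \<le> real n"
    and lower: "(real n - real t - 1)\<^sup>2 + real n - 1 \<le> real (\<Sum>i<n. card {j. G i j})"
  shows "graph_iso n G (extremal_graph n k m)"
proof -
  let ?V = "{0..<n}"
  let ?d = "\<lambda>i. card {j. G i j}"
  define s where "s = (k - 2) * m"
  have k1: "k - 1 = Suc (k - 2)" using k by simp
  have ts: "t = s + m + 1" unfolding t s_def k1 by simp
  have closed': "?d u + ?d v + s + 2 \<le> n" if "u < n" "v < n" "u \<noteq> v" "\<not> G u v" for u v
    using closed[OF that] by (simp add: s_def)
  define clique where "clique = (\<lambda>C. C \<subseteq> ?V \<and> (\<forall>i\<in>C. \<forall>j\<in>C. i \<noteq> j \<longrightarrow> G i j))"
  \<comment> \<open>Two nonadjacent vertices of \<open>D\<close> would violate the degree condition,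
    so \<open>D\<close> is a clique. Placing it inside \<open>K\<close> keeps every outside degree
    at most \<open>(n - s - 2) / 2\<close>.\<close>
  define D where "D = {i. i < n \<and> n < 2 * ?d i + s + 2}"
  have D: "clique D"
    unfolding clique_def
  proof (intro conjI ballI impI)
    fix i j assume "i \<in> D" "j \<in> D" "i \<noteq> j"
    then show "G i j" using closed'[of i j] by (force simp: D_def)
  qed (auto simp: D_def)
  have "finite {C. clique C}"
    by (rule finite_subset[of _ "Pow ?V"]) (auto simp: clique_def)
  then obtain K where K: "clique K" "D \<subseteq> K" and maximal: "\<And>C. clique C \<Longrightarrow> K \<subseteq> C \<Longrightarrow> K = C"
    using finite_has_maximal2[of "{C. clique C}" D] D by auto
  have KV: "K \<subseteq> ?V" and KG: "\<And>i j. i \<in> K \<Longrightarrow> j \<in> K \<Longrightarrow> i \<noteq> j \<Longrightarrow> G i j"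
    using K(1) by (auto simp: clique_def)
  have finK: "finite K" using KV finite_subset by blast
  define w where "w = card K"
  have wn: "w \<le> n" using card_mono[OF _ KV] by (simp add: w_def)
  have dK: "w \<le> ?d u + 1" if u: "u \<in> K" for u
  proof -
    have "card (K - {u}) \<le> ?d u"
      using KG u simple_graph_finite_nbrs[OF G] by (intro card_mono) auto
    then show ?thesis using u finK by (simp add: w_def)
  qed
  \<comment> \<open>By maximality of \<open>K\<close>, \<open>v\<close> misses some \<open>u\<close>
    in \<open>K\<close>, and \<open>u\<close> already has \<open>w - 1\<close> neighbours in the
    clique.\<close>
  have out: "?d v + w + s + 1 \<le> n" if v: "v \<in> ?V - K" for v
  proof -
    have "\<not> clique (insert v K)" using maximal[of "insert v K"] v by blast
    then obtain u where u: "u \<in> K" "\<not> G u v"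
      using K(1) v sympD[OF simple_graph_symp[OF G]] unfolding clique_def by blast
    then have "u < n" "u \<noteq> v" using KV v by auto
    then show ?thesis using closed'[of u v] u dK[OF u(1)] v by auto
  qed
  have half: "2 * ?d v + s + 2 \<le> n" if v: "v \<in> ?V - K" for v
    using v K(2) by (auto simp: D_def not_less)
  have "n \<le> w + t"
  proof (rule ccontr)
    assume "\<not> n \<le> w + t"
    then have wt: "real w \<le> real n - real t - 1" by linarith
    have card_out: "real (card (?V - K)) = real n - real w"
      using KV finK wn by (simp add: card_Diff_subset w_def)
    let ?D = "real (\<Sum>i<n. ?d i)"
    have sum_out: "(\<Sum>v\<in>?V - K. real (?d v)) \<le> (real n - real w) * b"
      if "\<And>v. v \<in> ?V - K \<Longrightarrow> real (?d v) \<le> b" for b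
      using sum_bounded_above[of "?V - K" "\<lambda>v. real (?d v)" b] that card_out by simp
    have w1: "real (w * (w - 1)) = real w * (real w - 1)" by (cases w) (auto simp: algebra_simps)
    have "?D \<le> real (w * (w - 1) + 2 * (\<Sum>v\<in>?V - K. ?d v))"
      using sum_card_clique_le[OF G KV] unfolding w_def by (rule of_nat_mono)
    also have "\<dots> = real w * (real w - 1) + 2 * (\<Sum>v\<in>?V - K. real (?d v))" using w1 by simp
    also have "\<dots> \<le> real w * (real w - 1) + 2 * ((real n - real w) * (real n - 1 - real s - real w))"
      by (intro add_left_mono mult_left_mono sum_out) (use out in \<open>force+\<close>)
    finally have upper1: "?D \<le> real w * (real w - 1) + 2 * ((real n - real w) * (real n - 1 - real s - real w))" .
    have dn: "real (?d u) \<le> real n - 1" if "u \<in> K" for u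
    proof -
      have u: "u < n" using that KV by auto
      have "?d u \<le> card (?V - {u})"
        using simple_graph_less[OF G] simple_graph_irrefl[OF G] by (intro card_mono) auto
      then show ?thesis using u by simp
    qed
    have "?D = (\<Sum>v\<in>?V - K. real (?d v)) + (\<Sum>u\<in>K. real (?d u))"
      using sum.subset_diff[OF KV, of "\<lambda>i. real (?d i)"] by (simp add: atLeast0LessThan)
    moreover have "(\<Sum>u\<in>K. real (?d u)) \<le> real w * (real n - 1)"
      using sum_bounded_above[of K "\<lambda>u. real (?d u)", OF dn] by (simp add: w_def)
    moreover have "(\<Sum>v\<in>?V - K. real (?d v)) \<le> (real n - real w) * ((real n - 2 - real s) / 2)"
      by (rule sum_out) (use half in force)
    ultimately have upper2: "?D \<le> real w * (real n - 1) + (real n - real w) * ((real n - 2 - real s) / 2)"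
      by linarith
    show False
      by (rule clique_size_bound[OF _ _ _ wt n lower upper1 upper2]) (use ts m in auto)
  qed
  have mindeg: "m \<le> ?d v" if "v < n" for v by (rule m_connected_min_degree[OF G mc that])
  have "?V \<noteq> K"
  proof
    assume "?V = K"
    then have "has_spanning_k_tree n G k" using KG k by (intro complete_has_spanning_k_tree) auto
    then show False using no by contradiction
  qed
  then obtain v0 where v0: "v0 \<in> ?V - K" using KV by blast
  \<comment> \<open>At an outside vertex the minimum degree \<open>m\<close> meets the upper bound
    \<open>n - 1 - s - w\<close>, which gives \<open>w + t \<le> n\<close>; equality then forces all
    outside degrees to be \<open>m\<close>.\<close>
  have wt: "w + t = n" using out[OF v0] mindeg[of v0] v0 ts \<open>n \<le> w + t\<close> by simp
  have dout: "?d v = m" if "v \<in> ?V - K" for v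
    using out[OF that] mindeg[of v] that ts wt by simp
  \<comment> \<open>Missing one outside vertex, of degree \<open>m\<close>, limits the degree of
    \<open>u\<close> to \<open>w - 1\<close>; its clique neighbours already exhaust this.\<close>
  have inner: "\<not> G u v'" if u: "u \<in> K" "\<not> G u v" and v: "v \<in> ?V - K" "v' \<in> ?V - K" for u v v'
  proof
    assume G': "G u v'"
    have "u < n" "u \<noteq> v" using u v KV by auto
    then have "?d u + m + s + 2 \<le> n" using closed'[of u v] u v dout[OF v(1)] by auto
    then have "?d u < w" using wt ts by simp
    moreover have "card (insert v' (K - {u})) \<le> ?d u"
      using KG u G' simple_graph_finite_nbrs[OF G] by (intro card_mono) auto
    moreover have "card (insert v' (K - {u})) = w"
      using v u finK card_gt_0_iff[of K] by (auto simp: w_def)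
    ultimately show False by simp
  qed
  define A where "A = {u \<in> K. G u v0}"
  have AK: "A \<subseteq> K" by (auto simp: A_def)
  have A: "G u v \<longleftrightarrow> u \<in> A" if "u \<in> K" "v \<in> ?V - K" for u v
    using inner[OF that(1) _ v0 that(2)] inner[OF that(1) _ that(2) v0] that by (auto simp: A_def)
  have sub: "A \<subseteq> {j. G v j}" if "v \<in> ?V - K" for v
    using A AK that sympD[OF simple_graph_symp[OF G]] by auto
  have cA: "card A = m"
  proof (rule antisym)
    show "card A \<le> m"
      using card_mono[OF simple_graph_finite_nbrs[OF G] sub[OF v0]] dout[OF v0] by simp
    \<comment> \<open>Removing \<open>A\<close> separates the rest of \<open>K\<close> from the
      outside vertices. Both sides are nonempty: \<open>v0\<close> lies outside \<open>K\<close>,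
      and \<open>A\<close> is smaller than \<open>K\<close>.\<close>
    show "m \<le> card A"
    proof (rule ccontr)
      assume "\<not> m \<le> card A"
      moreover from this have conn: "connected_on (?V - A) G"
        using mc AK KV unfolding m_connected_def by auto
      moreover have "m \<le> w"
      proof -
        have "real m + real t \<le> real n" using n(1) ts m by simp
        then show ?thesis using wt by linarith
      qed
      ultimately have "card A < card K" by (simp add: w_def)
      then have "\<not> K \<subseteq> A" using card_mono[of A K] finite_subset[OF AK finK] by auto
      then obtain u0 where u0: "u0 \<in> K" "u0 \<notin> A" by blast
      have u0': "u0 \<in> ?V - A" and v0': "v0 \<in> ?V - A" using u0 v0 KV AK by auto
      obtain i j where "i \<in> ?V - A" "j \<in> ?V - A" "G i j" "i \<in> K" "j \<notin> K"
        using connected_on_crossing[OF conn u0' v0', of "\<lambda>x. x \<in> K"] u0 v0 by blast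
      then show False using A[of i j] by auto
    qed
  qed
  \<comment> \<open>Since \<open>A\<close> already supplies all \<open>m\<close> neighbours, the
    outside vertices are independent.\<close>
  have N: "{j. G v j} = A" if "v \<in> ?V - K" for v
    using card_subset_eq[OF simple_graph_finite_nbrs[OF G] sub[OF that]] cA dout[OF that] by simp
  show ?thesis
  proof (rule graph_iso_extremal_graphI[OF G _ _ KV _ AK cA])
    show "k * m + 1 \<le> n"
    proof -
      have "k * m = (k - 1) * m + m" using k by (cases k) auto
      then have "real (k * m + 1) = real t + real m" by (simp add: t)
      also have "\<dots> \<le> real n" using n(1) ts m by simp
      finally show ?thesis by (simp only: of_nat_le_iff)
    qed
    show "card K + (k - 1) * m + 1 = n" using wt by (simp add: w_def t)
    show "G i j \<longleftrightarrow> i \<in> A \<or> j \<in> A \<or> (i \<in> K \<and> j \<in> K)" if ij: "i < n" "j < n" "i \<noteq> j" for i j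
    proof -
      consider "i \<in> K" "j \<in> K" | "i \<in> K" "j \<in> ?V - K" | "i \<in> ?V - K" using ij by auto
      then show ?thesis
      proof cases
        case 1
        then show ?thesis using KG ij by simp
      next
        case 2
        then show ?thesis using A[of i j] AK by auto
      next
        case 3
        then show ?thesis using N[OF 3] AK by auto
      qed
    qed
  qed (use k in simp)
qed

lemma simple_graph_extremal: "simple_graph n (extremal_graph n k m)"
  by (simp add: simple_graph_def extremal_graph_def) blast

section \<open>From the spectral hypothesis to the extremal graph\<close>

theorem theorem1p11:
  fixes n m k :: nat and E :: "nat \<Rightarrow> nat \<Rightarrow> bool"
  assumes "m \<ge> 1" and "k \<ge> 2"
    and "simple_graph n E"
    and "m_connected n E m"
    and "real n \<ge> real ((7*k - 2)*m + 4)"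
    and "real n \<ge> real ((k - 1)*m^2) + (3 * real k + 1) * real m / 2 + 9/2"
    and "rho n E \<ge> rho n (extremal_graph n k m)"
  shows "has_spanning_k_tree n E k \<or> graph_iso n E (extremal_graph n k m)"
proof (cases "has_spanning_k_tree n E k")
  case True
  then show ?thesis by simp
next
  case no: False
  note m = assms(1) and k = assms(2) and E = assms(3) and mc = assms(4)
  let ?H = "extremal_graph n k m"
  define t where "t = (k - 1) * m + 1"
  have rk: "real (k - 1) = real k - 1" using k by (simp add: of_nat_diff)
  have rt: "real t = (real k - 1) * real m + 1" by (simp only: t_def rk of_nat_add of_nat_mult of_nat_1)
  have "real (7 * k - 2) = 7 * real k - 2" using k by (simp add: of_nat_diff)
  then have "real ((7 * k - 2) * m + 4) = 7 * real t + 5 * real m - 3"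
    by (simp only: of_nat_add of_nat_mult) (simp add: rt algebra_simps)
  then have n1: "7 * real t + 5 * real m - 3 \<le> real n" using assms(5) by linarith
  have n2: "real t * real m + real m + 3 * real t / 2 + 3 \<le> real n"
    using assms(6) unfolding of_nat_mult of_nat_power rk
    by (simp add: rt power2_eq_square field_simps)
  have "n > 0" using mc by (simp add: m_connected_def)
  have "k * m = (k - 1) * m + m" using k by (cases k) auto
  then have "real (k * m + 1) = real t + real m" by (simp add: t_def)
  also have "\<dots> \<le> real n" using n1 m rt k by simp
  finally have kmn: "k * m + 1 \<le> n" by (simp only: of_nat_le_iff)
  \<comment> \<open>The first \<open>c = n - t\<close> vertices of the extremal graph form a clique,
    so its spectral radius is at least \<open>n - t - 1\<close>.\<close>
  define c where "c = m + (n - k * m - 1)"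
  have c: "c + t = n" using kmn \<open>k * m = (k - 1) * m + m\<close> by (simp add: c_def t_def)
  have "real (card {0..<c}) - 1 \<le> rho n ?H"
  proof (rule clique_le_rho[OF simple_graph_extremal])
    show "?H i j" if "i \<in> {0..<c}" "j \<in> {0..<c}" "i \<noteq> j" for i j
      using that c unfolding extremal_graph_def c_def[symmetric] by auto
  qed (use c m in \<open>auto simp: c_def\<close>)
  then have "real n - real t - 1 \<le> rho n E" using assms(7) c by simp
  \<comment> \<open>Squaring requires \<open>n - t - 1 \<ge> 0\<close>, which the first bound on
    \<open>n\<close> provides.\<close>
  then have "(real n - real t - 1)\<^sup>2 \<le> (rho n E)\<^sup>2"
    by (rule power_mono) (use n1 m rt k in simp)
  also have "\<dots> \<le> real (\<Sum>i<n. card {j. E i j}) - (real n - 1)"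
    using m_connected_min_degree[OF E mc] m order_trans
    by (intro rho_square_le_degree_sum[OF E \<open>n > 0\<close>]) blast
  finally have lowerE: "(real n - real t - 1)\<^sup>2 + real n - 1 \<le> real (\<Sum>i<n. card {j. E i j})" by simp
  define P where "P = (\<lambda>G. simple_graph n G \<and> (\<forall>i j. E i j \<longrightarrow> G i j) \<and> \<not> has_spanning_k_tree n G k)"
  define e where "e = (\<lambda>G :: nat \<Rightarrow> nat \<Rightarrow> bool. card {(i, j). G i j})"
  have edges: "{(i, j). G i j} \<subseteq> {0..<n} \<times> {0..<n}" if "P G" for G
    using simple_graph_less[of n G] that by (auto simp: P_def)
  have "e G \<le> n * n" if "P G" for G
    using card_mono[OF _ edges[OF that]] by (simp add: e_def)
  then have bound: "\<forall>G. P G \<longrightarrow> e G < Suc (n * n)" by (simp add: less_Suc_eq_le)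
  have "P E" using E no by (simp add: P_def)
  then obtain G where "P G" and greatest: "\<And>G'. P G' \<Longrightarrow> e G' \<le> e G"
    using Lattices_Big.ex_has_greatest_nat[OF _ bound] by blast
  then have G: "simple_graph n G" and EG: "\<And>i j. E i j \<Longrightarrow> G i j" and noG: "\<not> has_spanning_k_tree n G k"
    by (auto simp: P_def)
  have mcG: "m_connected n G m" using mc EG by (rule m_connected_mono)
  have iso: "graph_iso n G ?H"
  proof (rule closed_graph_is_extremal[OF G k m mcG noG _ t_def n1 n2])
    fix u v assume uv: "u < n" "v < n" "u \<noteq> v" "\<not> G u v"
    let ?G = "\<lambda>x y. G x y \<or> {x, y} = {u, v}"
    have GV: "a < n \<and> b < n" if "?G a b" for a b
      using that simple_graph_less[OF G] uv by (auto simp: doubleton_eq_iff)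
    have edges_plus: "{(i, j). ?G i j} = {(i, j). G i j} \<union> {(u, v), (v, u)}"
      by (auto simp: doubleton_eq_iff)
    have "finite {(i, j). G i j}" using edges[OF \<open>P G\<close>] by (rule finite_subset) simp
    then have "finite {(i, j). ?G i j}" unfolding edges_plus by simp
    moreover have "(u, v) \<notin> {(i, j). G i j}" using uv(4) by simp
    then have "{(i, j). G i j} \<subset> {(i, j). ?G i j}" unfolding edges_plus by blast
    ultimately have "e G < e ?G" unfolding e_def by (intro psubset_card_mono)
    then have "\<not> P ?G" using greatest[of ?G] by linarith
    moreover have "simple_graph n ?G"
      unfolding simple_graph_def
    proof (intro allI impI)
      fix a b assume ab: "?G a b"
      have "a \<noteq> b" using ab simple_graph_irrefl[OF G] uv(3) by (auto simp: doubleton_eq_iff)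
      moreover have "?G b a" using ab sympD[OF simple_graph_symp[OF G], of a b] insert_commute[of a b "{}"] by argo
      ultimately show "a < n \<and> b < n \<and> a \<noteq> b \<and> ?G b a" using GV[OF ab] by (intro conjI) simp_all
    qed
    ultimately have "has_spanning_k_tree n ?G k" unfolding P_def using EG by blast
    then show "card {j. G u j} + card {j. G v j} + (k - 2) * m + 2 \<le> n"
      by (rule spanning_k_tree_closure[OF G k mcG uv _ noG])
  next
    \<comment> \<open>Hong's inequality was applied to \<open>E\<close>; passing to the supergraph
      \<open>G\<close> only increases degrees.\<close>
    have "(\<Sum>i<n. card {j. E i j}) \<le> (\<Sum>i<n. card {j. G i j})"
      using EG simple_graph_finite_nbrs[OF G] by (intro sum_mono card_mono) auto
    then have "real (\<Sum>i<n. card {j. E i j}) \<le> real (\<Sum>i<n. card {j. G i j})" by (rule of_nat_mono)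
    then show "(real n - real t - 1)\<^sup>2 + real n - 1 \<le> real (\<Sum>i<n. card {j. G i j})"
      using lowerE by linarith
  qed
  have "E = G"
  proof (rule ccontr)
    assume "E \<noteq> G"
    have "connected_on ({0..<n} - {}) G" using mcG m unfolding m_connected_def by auto
    then have "rho n E < rho n G" using E G EG \<open>E \<noteq> G\<close> by (intro rho_strict_mono) auto
    also obtain f where f: "bij_betw f {0..<n} {0..<n}" "\<forall>i<n. \<forall>j<n. G i j \<longleftrightarrow> ?H (f i) (f j)"
      using iso by (auto simp: graph_iso_def)
    have "rho n G \<le> rho n ?H"
    proof (rule rho_le_of_embedding[OF G simple_graph_extremal \<open>n > 0\<close>])
      show "inj_on f {0..<n}" using f(1) by (rule bij_betw_imp_inj_on)
      show "f i < n" if "i < n" for i using bij_betwE[OF f(1)] that by auto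
      show "?H (f i) (f j)" if "G i j" for i j using f(2) that simple_graph_less[OF G that] by blast
    qed
    finally show False using assms(7) by simp
  qed
  then show ?thesis using iso by simp
qed

end
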